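(* Let $U\subset\mathbb{R}^n$ be open and bounded, and let $\mathcal{P}_0(\xi)=\xi$ for every $\xi\in\partial U$. Assume that for all $t_0\in[0,T]$, $\xi\in\mathbb{R}^n$ and $\varepsilon\in(0,1]$ the solution $x$ of $\dot x=f(t,x)+\varepsilon g(t,x,\varepsilon)$ with $x(t_0)=\xi$ exists, is unique and extends to $[0,T]$, and that $$\Phi^s(\xi)\neq0\quad\text{for every }\xi\in\partial U\text{ and every }s\in[0,T].$$ Then there exists $\varepsilon_0>0$ such that for $\varepsilon\in(0,\varepsilon_0]$ one has $\mathcal{P}_\varepsilon(\xi)\ne\xi$ for all $\xi\in\partial U$, and $$d_{\mathbb{R}^n}(I-\mathcal{P}_\varepsilon,U)=d_{\mathbb{R}^n}(-\Phi^T,U),\qquad \varepsilon\in(0,\varepsilon_0].$$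
   Context: $T>0$; $f:\mathbb{R}\times\mathbb{R}^n\to\mathbb{R}^n$ is continuously differentiable, $g:\mathbb{R}\times\mathbb{R}^n\times[0,1]\to\mathbb{R}^n$ is continuous, both $T$-periodic in the first variable. $\Omega(\cdot,t_0,\xi)$ is the solution of $\dot x=f(t,x)$ with value $\xi$ at time $t_0$; it is assumed that these solutions extend to $[0,T]$ for all $t_0\in[0,T]$, $\xi\in\mathbb{R}^n$. $\mathcal{P}_\varepsilon(\xi)$ is the value at time $T$ of the solution of $\dot x=f(t,x)+\varepsilon g(t,x,\varepsilon)$ with $x(0)=\xi$; in particular $\mathcal{P}_0(\xi)=\Omega(T,0,\xi)$. The generalized averaging operator $\Phi^s:\mathbb{R}^n\to\mathbb{R}^n$, $s\in[0,T]$, is $\Phi^s(\xi)=\eta(T,s,\xi)-\eta(0,s,\xi)$, where $\eta(\cdot,s,\xi)$ is the solution of $$\dot y=f'_x(t,\Omega(t,0,\xi))\,y+g(t,\Omega(t,0,\xi),0)$$ with $\eta(s,s,\xi)=0$ ($f'_x$ is the derivative of $f$ in the second variable). $d_{\mathbb{R}^n}$ is the Brouwer degree with respect to $0$. *)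

theory Defs
  imports "HOL-Analysis.Analysis" "HOL-Homology.Homology"
begin

section \<open>Brouwer degree\<close>

abbreviation homology_top :: "'a::euclidean_space topology \<Rightarrow> 'a set \<Rightarrow> 'a chain set monoid"
  where "homology_top X S \<equiv> relative_homology_group (int DIM('a)) X S"

abbreviation induced_top ::
  "'a::euclidean_space topology \<Rightarrow> 'a set \<Rightarrow> 'a topology \<Rightarrow> 'a set \<Rightarrow> ('a \<Rightarrow> 'a) \<Rightarrow> 'a chain set \<Rightarrow> 'a chain set"
  where "induced_top X S Y T f \<equiv> hom_induced (int DIM('a)) X S Y T f"

text \<open>
  Dold's definition of the Brouwer degree with respect to \<open>0\<close> (Lectures on Algebraic Topology, IV.5).
  Let \<open>n\<close> be the dimension and \<open>K\<close> a compact subset of the open bounded set \<open>U\<close> containing all zeros of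
  \<open>f\<close> in \<open>U\<close>. A class \<open>c\<close> of \<open>H\<^sub>n(\<real>\<^sup>n, \<real>\<^sup>n - ball)\<close>, the ball containing \<open>U\<close>, is restricted to
  \<open>H\<^sub>n(\<real>\<^sup>n, \<real>\<^sup>n - K)\<close> and moved by excision to a class \<open>b\<close> of \<open>H\<^sub>n(U, U - K)\<close>; then
  \<open>f\<^sub>* b\<close> in the infinite cyclic group \<open>H\<^sub>n(\<real>\<^sup>n, \<real>\<^sup>n - {0})\<close> is the \<open>d\<close>-th power (groups are
  written multiplicatively) of the restriction of \<open>c\<close>. No generator has to be chosen.
\<close>

definition degree_along :: "('a::euclidean_space \<Rightarrow> 'a) \<Rightarrow> 'a set \<Rightarrow> 'a set \<Rightarrow> int \<Rightarrow> bool"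
  where "degree_along f U K d \<longleftrightarrow>
    (\<forall>r > 0. U \<subseteq> ball 0 r \<longrightarrow>
      (\<forall>c \<in> carrier (homology_top euclidean (- ball 0 r)).
       \<forall>b \<in> carrier (homology_top (top_of_set U) (U - K)).
         induced_top (top_of_set U) (U - K) euclidean (- K) id b =
         induced_top euclidean (- ball 0 r) euclidean (- K) id c \<longrightarrow>
         induced_top (top_of_set U) (U - K) euclidean (- {0}) f b =
         induced_top euclidean (- ball 0 r) euclidean (- {0}) id c
           [^]\<^bsub>homology_top euclidean (- {0::'a})\<^esub> d))"

definition brouwer_degree :: "('a::euclidean_space \<Rightarrow> 'a) \<Rightarrow> 'a set \<Rightarrow> int"
  where "brouwer_degree f U = (THE d. degree_along f U {x \<in> U. f x = 0} d)"

text \<open>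
  For \<open>f\<close> continuous on the closure of \<open>U\<close> and without zeros on the frontier the description is proper:
  exactly one \<open>d\<close> exists (\<open>degree_along_exists_unique\<close>), it does not depend on \<open>K\<close>
  (\<open>brouwer_degree_along\<close>), and the three axioms of Amann and Weiss, which characterise the Brouwer
  degree, hold (\<open>brouwer_degree_translation\<close>, \<open>brouwer_degree_additive\<close>, \<open>brouwer_degree_homotopy\<close>).
\<close>

lemma iso_excision_nbhd:
  fixes U V K :: "'a::topological_space set"
  assumes "open U" "U \<subseteq> V" "K \<subseteq> U" "closed K"
  shows "hom_induced p (top_of_set U) (U - K) (top_of_set V) (V - K) id
    \<in> iso (relative_homology_group p (top_of_set U) (U - K))
          (relative_homology_group p (top_of_set V) (V - K))"
proof -
  have cl: "top_of_set V closure_of (V - U) = V - U"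
    using assms by (intro closure_of_closedin) (auto simp: closedin_closed intro!: exI[of _ "- U"])
  have "openin (top_of_set V) (V - K)"
    using assms by (metis Diff_eq Int_commute open_Compl openin_open)
  then have it: "top_of_set V interior_of (V - K) = V - K"
    by (simp add: interior_of_openin)
  have "hom_induced p (subtopology (top_of_set V) (V - (V - U))) ((V - K) - (V - U)) (subtopology (top_of_set V) V) (V - K) id
    \<in> iso (relative_homology_group p (subtopology (top_of_set V) (V - (V - U))) ((V - K) - (V - U)))
          (relative_homology_group p (subtopology (top_of_set V) V) (V - K))"
    by (rule homology_excision_axiom) (use assms in \<open>auto simp: cl it\<close>)
  moreover have "V - (V - U) = U" "(V - K) - (V - U) = U - K"
    using assms by auto
  moreover have "V \<inter> U = U" using assms by auto
  ultimately show ?thesis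
    by (simp add: subtopology_subtopology)
qed

lemma homotopic_radial:
  fixes r :: real
  assumes r: "r > 0" and S: "sphere 0 r \<subseteq> S" "S \<subseteq> - {0}"
    "\<And>x t. x \<in> S \<Longrightarrow> 0 \<le> t \<Longrightarrow> t \<le> 1 \<Longrightarrow> ((1 - t) * (r / norm x) + t) *\<^sub>R x \<in> S"
  shows "hom_induced p (top_of_set (sphere (0::'a::euclidean_space) r)) {} (top_of_set S) {} id
     \<in> iso (reduced_homology_group p (top_of_set (sphere 0 r))) (reduced_homology_group p (top_of_set S))"
proof (rule homotopy_equivalence_reduced_homology_group_isomorphism)
  let ?g = "\<lambda>x::'a. (r / norm x) *\<^sub>R x"
  have nz: "x \<noteq> 0" if "x \<in> S" for x using S that by auto
  show "continuous_map (top_of_set (sphere 0 r)) (top_of_set S) id"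
    using S by (auto simp: continuous_map_in_subtopology)
  have gc: "continuous_on S ?g"
    by (intro continuous_intros) (use nz in auto)
  show "continuous_map (top_of_set S) (top_of_set (sphere 0 r)) ?g"
    using gc nz r by (auto simp: continuous_map_in_subtopology)
  show "homotopic_with (\<lambda>h. True) (top_of_set (sphere 0 r)) (top_of_set (sphere 0 r)) (?g \<circ> id) id"
    by (rule homotopic_with_equal)
       (use r gc S in \<open>auto simp: continuous_map_in_subtopology intro: continuous_on_subset\<close>)
  have "continuous_map (top_of_set ({0..1} \<times> S)) (top_of_set S) (\<lambda>(t, x). ((1 - t) * (r / norm x) + t) *\<^sub>R x)"
    using S(3) nz by (auto simp: continuous_map_in_subtopology split_def intro!: continuous_intros)
  then show "homotopic_with (\<lambda>k. True) (top_of_set S) (top_of_set S) (id \<circ> ?g) id"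
    unfolding homotopic_with_def
    by (intro exI[of _ "\<lambda>(t, x). ((1 - t) * (r / norm x) + t) *\<^sub>R x"])
       (auto simp: prod_topology_subtopology_eu)
qed

lemma homology_local_generator:
  obtains a where
    "a \<in> carrier (relative_homology_group (int DIM('a)) euclidean (- {0::'a::euclidean_space}))"
    "\<And>x. x \<in> carrier (relative_homology_group (int DIM('a)) euclidean (- {0::'a})) \<Longrightarrow>
      \<exists>k::int. x = a [^]\<^bsub>relative_homology_group (int DIM('a)) euclidean (- {0::'a})\<^esub> k"
    "\<And>i j::int. a [^]\<^bsub>relative_homology_group (int DIM('a)) euclidean (- {0::'a})\<^esub> i =
      a [^]\<^bsub>relative_homology_group (int DIM('a)) euclidean (- {0::'a})\<^esub> j \<Longrightarrow> i = j"
proof -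
  let ?n = "int DIM('a)"
  let ?G = "relative_homology_group ?n euclidean (- {0::'a})"
  have c: "contractible_space (euclidean :: 'a topology)"
    using starlike_imp_contractible[OF starlike_UNIV]
    by (auto simp: contractible_space_def contractible_def)
  have ne: "- {0::'a} \<noteq> {}"
    by (metis Compl_iff SOME_Basis empty_iff insertE nonzero_Basis)
  have 1: "?G \<cong> reduced_homology_group (?n - 1) (top_of_set (- {0::'a}))"
    using isomorphic_group_relative_homology_of_contractible[OF c, of "- {0}" ?n] ne by auto
  have "hom_induced (?n - 1) (top_of_set (sphere (0::'a) 1)) {} (top_of_set (- {0})) {} id
     \<in> iso (reduced_homology_group (?n - 1) (top_of_set (sphere 0 1)))
           (reduced_homology_group (?n - 1) (top_of_set (- {0})))"
  proof (rule homotopic_radial)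
    fix x :: 'a and t :: real assume *: "x \<in> - {0}" "0 \<le> t" "t \<le> 1"
    have "(1 - t) * (1 / norm x) + t > 0"
      using * by (cases "t = 1") (auto intro!: add_pos_nonneg)
    then show "((1 - t) * (1 / norm x) + t) *\<^sub>R x \<in> - {0}"
      using * by auto
  qed auto
  then have 2: "reduced_homology_group (?n - 1) (top_of_set (sphere (0::'a) 1)) \<cong>
     reduced_homology_group (?n - 1) (top_of_set (- {0::'a}))"
    by (rule is_isoI)
  obtain f g where "homeomorphic_maps (nsphere (DIM('a) - 1)) (top_of_set (sphere (0::'a) 1 \<inter> span Basis)) f g"
    by (rule homeomorphic_maps_nsphere_euclidean_sphere[OF independent_Basis orthogonal_Basis refl, where 'n='a])
       (use that DIM_positive[where 'a='a] in \<open>simp_all add: norm_Basis\<close>)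
  then have "nsphere (DIM('a) - 1) homeomorphic_space top_of_set (sphere (0::'a) 1)"
    by (auto simp: homeomorphic_space_def)
  then have 3: "reduced_homology_group (?n - 1) (nsphere (DIM('a) - 1)) \<cong>
     reduced_homology_group (?n - 1) (top_of_set (sphere (0::'a) 1))"
    by (rule homeomorphic_space_imp_isomorphic_reduced_homology_groups)
  have "int (DIM('a) - 1) = ?n - 1"
    using DIM_positive[where 'a='a] by linarith
  then have 4: "reduced_homology_group (?n - 1) (nsphere (DIM('a) - 1)) \<cong> integer_group"
    using reduced_homology_group_nsphere(1)[of "DIM('a) - 1"] by simp
  have "integer_group \<cong> ?G"
    by (rule group.iso_sym[OF group_relative_homology_group])
       (rule iso_trans[OF 1 iso_trans[OF group.iso_sym[OF group_reduced_homology_group 2]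
           iso_trans[OF group.iso_sym[OF group_reduced_homology_group 3] 4]]])
  then obtain h where h: "h \<in> iso integer_group ?G"
    by (auto simp: is_iso_def)
  then have hh: "h \<in> hom integer_group ?G" and bij: "bij_betw h UNIV (carrier ?G)"
    by (auto simp: iso_def)
  have pw: "h k = h 1 [^]\<^bsub>?G\<^esub> k" for k
  proof -
    interpret group_hom integer_group ?G h
      by (simp add: group_hom_def group_hom_axioms_def hh)
    show ?thesis using hom_int_pow[of 1 k] by simp
  qed
  show ?thesis
  proof
    show "h 1 \<in> carrier ?G" using bij by (auto simp: bij_betw_def)
    show "\<exists>k::int. x = h 1 [^]\<^bsub>?G\<^esub> k" if "x \<in> carrier ?G" for x
      using that bij pw by (metis bij_betw_iff_bijections)
    show "i = j" if "h 1 [^]\<^bsub>?G\<^esub> i = h 1 [^]\<^bsub>?G\<^esub> j" for i j :: int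
      using that bij by (simp flip: pw add: bij_betw_def inj_eq)
  qed
qed

lemma iso_restrict_ball:
  fixes r :: real
  assumes "r > 0"
  shows "hom_induced p euclidean (- ball (0::'a::euclidean_space) r) euclidean (- {0}) id
    \<in> iso (relative_homology_group p euclidean (- ball 0 r)) (relative_homology_group p euclidean (- {0}))"
proof -
  let ?B = "- ball (0::'a) r" and ?S = "sphere (0::'a) r" and ?N = "- {0::'a}"
  have c: "contractible_space (euclidean :: 'a topology)"
    using starlike_imp_contractible[OF starlike_UNIV]
    by (auto simp: contractible_space_def contractible_def)
  have neS: "?S \<noteq> {}" using assms by (simp add: sphere_eq_empty)
  have sub: "?S \<subseteq> ?B" "?B \<subseteq> ?N" "?S \<subseteq> ?N" using assms by auto
  have b1: "hom_boundary p euclidean ?B \<in> iso (relative_homology_group p euclidean ?B) (reduced_homology_group (p - 1) (top_of_set ?B))"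
    by (rule iso_relative_homology_of_contractible[OF c]) (use neS sub in auto)
  have b2: "hom_boundary p euclidean ?N \<in> iso (relative_homology_group p euclidean ?N) (reduced_homology_group (p - 1) (top_of_set ?N))"
    by (rule iso_relative_homology_of_contractible[OF c]) (use neS sub in auto)
  have h1: "hom_induced (p - 1) (top_of_set ?S) {} (top_of_set ?B) {} id
     \<in> iso (reduced_homology_group (p - 1) (top_of_set ?S)) (reduced_homology_group (p - 1) (top_of_set ?B))"
  proof (rule homotopic_radial[OF assms sub(1,2)])
    fix x :: 'a and t :: real assume *: "x \<in> ?B" "0 \<le> t" "t \<le> 1"
    then have nx: "norm x \<ge> r" "norm x > 0" using assms by auto
    have "(1 - t) * (r / norm x) + t \<ge> 0"
      using * nx assms by auto
    then have "norm (((1 - t) * (r / norm x) + t) *\<^sub>R x) = ((1 - t) * (r / norm x) + t) * norm x"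
      by simp
    also have "\<dots> = (1 - t) * r + t * norm x"
      using nx by (simp add: field_simps)
    also have "\<dots> \<ge> (1 - t) * r + t * r"
      using * nx by (intro add_left_mono mult_left_mono) auto
    finally show "((1 - t) * (r / norm x) + t) *\<^sub>R x \<in> ?B"
      by (simp add: algebra_simps)
  qed
  have h2: "hom_induced (p - 1) (top_of_set ?S) {} (top_of_set ?N) {} id
     \<in> iso (reduced_homology_group (p - 1) (top_of_set ?S)) (reduced_homology_group (p - 1) (top_of_set ?N))"
  proof (rule homotopic_radial[OF assms sub(3)])
    fix x :: 'a and t :: real assume *: "x \<in> ?N" "0 \<le> t" "t \<le> 1"
    have "(1 - t) * (r / norm x) + t > 0"
      using * assms by (cases "t = 1") (auto intro!: add_pos_nonneg)
    then show "((1 - t) * (r / norm x) + t) *\<^sub>R x \<in> ?N"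
      using * by auto
  qed auto
  have cmp: "hom_induced (p - 1) (top_of_set ?S) {} (top_of_set ?N) {} id x =
     hom_induced (p - 1) (top_of_set ?B) {} (top_of_set ?N) {} id
       (hom_induced (p - 1) (top_of_set ?S) {} (top_of_set ?B) {} id x)" for x
    by (subst hom_induced_compose') (use sub in \<open>auto simp: continuous_map_in_subtopology\<close>)
  have nat: "hom_boundary p euclidean ?N (hom_induced p euclidean ?B euclidean ?N id x) =
     hom_induced (p - 1) (top_of_set ?B) {} (top_of_set ?N) {} id (hom_boundary p euclidean ?B x)" for x
  proof -
    have "id \<in> ?B \<rightarrow> ?N" using sub by auto
    from fun_cong[OF naturality_hom_induced[OF _ this, of euclidean euclidean p], of x]
    show ?thesis by simp
  qed
  let ?i = "hom_induced p euclidean ?B euclidean ?N id"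
  let ?j = "hom_induced (p - 1) (top_of_set ?B) {} (top_of_set ?N) {} id"
  have "bij_betw (?j \<circ> hom_induced (p - 1) (top_of_set ?S) {} (top_of_set ?B) {} id)
     (carrier (reduced_homology_group (p - 1) (top_of_set ?S))) (carrier (reduced_homology_group (p - 1) (top_of_set ?N)))"
    using h2 by (simp add: iso_def o_def flip: cmp)
  then have "bij_betw ?j (carrier (reduced_homology_group (p - 1) (top_of_set ?B)))
      (carrier (reduced_homology_group (p - 1) (top_of_set ?N)))"
    using h1 by (subst bij_betw_comp_iff) (auto simp: iso_def)
  then have "bij_betw (?j \<circ> hom_boundary p euclidean ?B) (carrier (relative_homology_group p euclidean ?B))
      (carrier (reduced_homology_group (p - 1) (top_of_set ?N)))"
    using b1 by (intro bij_betw_trans) (auto simp: iso_def)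
  then have "bij_betw (hom_boundary p euclidean ?N \<circ> ?i) (carrier (relative_homology_group p euclidean ?B))
      (carrier (reduced_homology_group (p - 1) (top_of_set ?N)))"
    by (simp add: o_def nat)
  then have "bij_betw ?i (carrier (relative_homology_group p euclidean ?B)) (carrier (relative_homology_group p euclidean ?N))"
    using b2 by (subst bij_betw_comp_iff2) (auto simp: iso_def hom_induced_carrier)
  then show ?thesis
    by (simp add: iso_def hom_induced_hom)
qed

lemma iso_excision_UNIV:
  assumes "open U" "K \<subseteq> U" "closed K"
  shows "induced_top (top_of_set U) (U - K) euclidean (- K) id
    \<in> iso (homology_top (top_of_set U) (U - K)) (homology_top euclidean (- K))"
  using iso_excision_nbhd[of U UNIV K] assms by (simp add: Compl_eq_Diff_UNIV)

lemma excision_lift: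
  assumes "open U" "K \<subseteq> U" "closed K" "c \<in> carrier (homology_top euclidean (- K))"
  obtains b where "b \<in> carrier (homology_top (top_of_set U) (U - K))"
    "induced_top (top_of_set U) (U - K) euclidean (- K) id b = c"
proof -
  have "induced_top (top_of_set U) (U - K) euclidean (- K) id ` carrier (homology_top (top_of_set U) (U - K))
    = carrier (homology_top euclidean (- K))"
    using iso_excision_UNIV[OF assms(1-3)] by (simp add: iso_def bij_betw_def)
  then have "c \<in> induced_top (top_of_set U) (U - K) euclidean (- K) id ` carrier (homology_top (top_of_set U) (U - K))"
    using assms(4) by (simp only:)
  then show ?thesis
    by (rule imageE) (rule that, assumption, rule sym, assumption)
qed

lemma excision_inj:
  assumes "open U" "K \<subseteq> U" "closed K"
    "b \<in> carrier (homology_top (top_of_set U) (U - K))" "b' \<in> carrier (homology_top (top_of_set U) (U - K))"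
    "induced_top (top_of_set U) (U - K) euclidean (- K) id b = induced_top (top_of_set U) (U - K) euclidean (- K) id b'"
  shows "b = b'"
proof -
  have "inj_on (induced_top (top_of_set U) (U - K) euclidean (- K) id) (carrier (homology_top (top_of_set U) (U - K)))"
    using iso_excision_UNIV[OF assms(1-3)] by (simp add: iso_def bij_betw_def)
  from inj_onD[OF this assms(6,4,5)] show ?thesis .
qed

lemma group_hom_induced: "group_hom (relative_homology_group p X S) (relative_homology_group p Y T) (hom_induced p X S Y T f)"
  by (simp add: group_hom_def group_hom_axioms_def hom_induced_hom)

lemma hom_induced_id_then:
  assumes "continuous_map X Y id" "continuous_map Y Z f" "S \<subseteq> T" "f ` T \<subseteq> V"
  shows "hom_induced p Y T Z V f (hom_induced p X S Y T id x) = hom_induced p X S Z V f x"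
  using hom_induced_compose'[OF assms(1) _ assms(2), of S T V p x] assms(3,4)
  by (simp add: Pi_iff subset_iff image_subset_iff)

lemma hom_induced_id_id:
  assumes "continuous_map X Y id" "continuous_map Y Z id" "S \<subseteq> T" "T \<subseteq> V"
  shows "hom_induced p Y T Z V id (hom_induced p X S Y T id x) = hom_induced p X S Z V id x"
  using assms by (simp add: hom_induced_id_then)

lemma degree_along_enlarge:
  assumes U: "open U" and K: "closed K" "closed K'" "K \<subseteq> K'" "K' \<subseteq> U"
    and f: "continuous_on U f" "\<And>x. x \<in> U - K \<Longrightarrow> f x \<noteq> 0"
  shows "degree_along f U K d \<longleftrightarrow> degree_along f U K' d"
proof -
  let ?X = "top_of_set U"
  have fc: "continuous_map ?X euclidean f" using f by simp
  have push: "induced_top ?X (U - K) euclidean (- K) id (induced_top ?X (U - K') ?X (U - K) id b)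
      = induced_top euclidean (- K') euclidean (- K) id (induced_top ?X (U - K') euclidean (- K') id b)"
    "induced_top ?X (U - K) euclidean (- {0}) f (induced_top ?X (U - K') ?X (U - K) id b)
      = induced_top ?X (U - K') euclidean (- {0}) f b" for b
  proof -
    have KK: "U - K' \<subseteq> U - K" "- K' \<subseteq> - K" "f ` (U - K) \<subseteq> - {0}" using K f by auto
    show "induced_top ?X (U - K) euclidean (- K) id (induced_top ?X (U - K') ?X (U - K) id b)
      = induced_top euclidean (- K') euclidean (- K) id (induced_top ?X (U - K') euclidean (- K') id b)"
    proof (rule trans)
      show "induced_top ?X (U - K) euclidean (- K) id (induced_top ?X (U - K') ?X (U - K) id b)
        = induced_top ?X (U - K') euclidean (- K) id b"
        by (rule hom_induced_id_id) (use KK in auto)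
      show "induced_top ?X (U - K') euclidean (- K) id b
        = induced_top euclidean (- K') euclidean (- K) id (induced_top ?X (U - K') euclidean (- K') id b)"
        by (rule hom_induced_id_id[symmetric]) (use KK in auto)
    qed
    show "induced_top ?X (U - K) euclidean (- {0}) f (induced_top ?X (U - K') ?X (U - K) id b)
      = induced_top ?X (U - K') euclidean (- {0}) f b"
      by (rule hom_induced_id_then) (simp_all only: KK fc continuous_map_id)
  qed
  have res: "induced_top euclidean (- K') euclidean (- K) id (induced_top euclidean (- ball 0 r) euclidean (- K') id c)
     = induced_top euclidean (- ball 0 r) euclidean (- K) id c" if "U \<subseteq> ball 0 r" for r c
    by (rule hom_induced_id_id) (use K that in auto)
  show ?thesis
  proof
    assume L: "degree_along f U K d"
    show "degree_along f U K' d"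
      unfolding degree_along_def
    proof (intro allI impI ballI)
      fix r :: real and c b
      assume *: "0 < r" "U \<subseteq> ball 0 r" "c \<in> carrier (homology_top euclidean (- ball 0 r))"
        "b \<in> carrier (homology_top ?X (U - K'))"
        "induced_top ?X (U - K') euclidean (- K') id b = induced_top euclidean (- ball 0 r) euclidean (- K') id c"
      show "induced_top ?X (U - K') euclidean (- {0}) f b =
         induced_top euclidean (- ball 0 r) euclidean (- {0}) id c [^]\<^bsub>homology_top euclidean (- {0})\<^esub> d"
        using L[unfolded degree_along_def, rule_format, OF *(1-3), of "induced_top ?X (U - K') ?X (U - K) id b"]
        by (simp add: push hom_induced_carrier *(5) res[OF *(2)])
    qed
  next
    assume R: "degree_along f U K' d"
    show "degree_along f U K d"
      unfolding degree_along_def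
    proof (intro allI impI ballI)
      fix r :: real and c b
      assume *: "0 < r" "U \<subseteq> ball 0 r" "c \<in> carrier (homology_top euclidean (- ball 0 r))"
        "b \<in> carrier (homology_top ?X (U - K))"
        "induced_top ?X (U - K) euclidean (- K) id b = induced_top euclidean (- ball 0 r) euclidean (- K) id c"
      obtain b' where b': "b' \<in> carrier (homology_top ?X (U - K'))"
        "induced_top ?X (U - K') euclidean (- K') id b' = induced_top euclidean (- ball 0 r) euclidean (- K') id c"
        by (rule excision_lift[OF U K(4) K(2) hom_induced_carrier])
      have "K \<subseteq> U" using K by auto
      then have "b = induced_top ?X (U - K') ?X (U - K) id b'"
        by (rule excision_inj[OF U _ K(1) *(4) hom_induced_carrier]) (simp only: push(1) b'(2) res[OF *(2)] *(5))
      then show "induced_top ?X (U - K) euclidean (- {0}) f b =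
         induced_top euclidean (- ball 0 r) euclidean (- {0}) id c [^]\<^bsub>homology_top euclidean (- {0})\<^esub> d"
        using R[unfolded degree_along_def, rule_format, OF *(1-3) b'] by (simp add: push)
    qed
  qed
qed

lemma degree_along_exists_unique:
  fixes f :: "'a::euclidean_space \<Rightarrow> 'a"
  assumes U: "open U" "bounded U" and K: "closed K" "K \<subseteq> U"
    and f: "continuous_on U f" "\<And>x. x \<in> U - K \<Longrightarrow> f x \<noteq> 0"
  shows "\<exists>!d. degree_along f U K d"
proof -
  let ?X = "top_of_set U" and ?G = "homology_top euclidean (- {0::'a})"
  obtain r0 where r0: "r0 > 0" "U \<subseteq> ball 0 r0"
    using bounded_subset_ballD[OF U(2)] by blast
  obtain a where a: "a \<in> carrier ?G" "\<And>x. x \<in> carrier ?G \<Longrightarrow> \<exists>k::int. x = a [^]\<^bsub>?G\<^esub> k"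
    "\<And>i j::int. a [^]\<^bsub>?G\<^esub> i = a [^]\<^bsub>?G\<^esub> j \<Longrightarrow> i = j"
    by (rule homology_local_generator[where 'a='a]) blast
  interpret G: group ?G by simp
  define R where "R r d \<longleftrightarrow> (\<forall>c \<in> carrier (homology_top euclidean (- ball 0 r)).
       \<forall>b \<in> carrier (homology_top ?X (U - K)).
         induced_top ?X (U - K) euclidean (- K) id b = induced_top euclidean (- ball 0 r) euclidean (- K) id c \<longrightarrow>
         induced_top ?X (U - K) euclidean (- {0}) f b =
         induced_top euclidean (- ball 0 r) euclidean (- {0}) id c [^]\<^bsub>?G\<^esub> d)" for r and d :: int
  have DR: "degree_along f U K d \<longleftrightarrow> (\<forall>r > 0. U \<subseteq> ball 0 r \<longrightarrow> R r d)" for d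
    by (simp only: degree_along_def R_def)
  have top: "\<exists>c\<in>carrier (homology_top euclidean (- ball 0 r)). induced_top euclidean (- ball 0 r) euclidean (- {0}) id c = a"
    if "r > 0" for r
  proof -
    have "induced_top euclidean (- ball 0 r) euclidean (- {0}) id ` carrier (homology_top euclidean (- ball 0 r)) = carrier ?G"
      using iso_restrict_ball[where 'a='a, OF that, of "int DIM('a)"] by (simp add: iso_def bij_betw_def)
    then have "a \<in> induced_top euclidean (- ball 0 r) euclidean (- {0}) id ` carrier (homology_top euclidean (- ball 0 r))"
      using a(1) by (simp only:)
    then show ?thesis
      by (rule imageE) (rule bexI, rule sym, assumption, assumption)
  qed
  have ex: "\<exists>d. R r d" if r: "r > 0" "U \<subseteq> ball 0 r" for r
  proof -
    let ?B = "- ball (0::'a) r"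
    interpret ib: group_hom "homology_top euclidean ?B" ?G "induced_top euclidean ?B euclidean (- {0}) id"
      by (rule group_hom_induced)
    interpret iK: group_hom "homology_top euclidean ?B" "homology_top euclidean (- K)" "induced_top euclidean ?B euclidean (- K) id"
      by (rule group_hom_induced)
    interpret ie: group_hom "homology_top ?X (U - K)" "homology_top euclidean (- K)" "induced_top ?X (U - K) euclidean (- K) id"
      by (rule group_hom_induced)
    interpret iff: group_hom "homology_top ?X (U - K)" ?G "induced_top ?X (U - K) euclidean (- {0}) f"
      by (rule group_hom_induced)
    obtain c0 where c0: "c0 \<in> carrier (homology_top euclidean ?B)" "induced_top euclidean ?B euclidean (- {0}) id c0 = a"
      using top r by blast
    obtain b0 where b0: "b0 \<in> carrier (homology_top ?X (U - K))"
      "induced_top ?X (U - K) euclidean (- K) id b0 = induced_top euclidean ?B euclidean (- K) id c0"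
      by (rule excision_lift[OF U(1) K(2) K(1) hom_induced_carrier])
    obtain d :: int where d: "induced_top ?X (U - K) euclidean (- {0}) f b0 = a [^]\<^bsub>?G\<^esub> d"
      using a(2)[OF hom_induced_carrier] by blast
    have "R r d"
      unfolding R_def
    proof (intro ballI impI)
      fix c b
      assume *: "c \<in> carrier (homology_top euclidean ?B)" "b \<in> carrier (homology_top ?X (U - K))"
        "induced_top ?X (U - K) euclidean (- K) id b = induced_top euclidean ?B euclidean (- K) id c"
      obtain k :: int where k: "induced_top euclidean ?B euclidean (- {0}) id c = a [^]\<^bsub>?G\<^esub> k"
        using a(2)[OF hom_induced_carrier] by blast
      have ck: "c = c0 [^]\<^bsub>homology_top euclidean ?B\<^esub> k"
      proof -
        have "inj_on (induced_top euclidean ?B euclidean (- {0}) id) (carrier (homology_top euclidean ?B))"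
          using iso_restrict_ball[where 'a='a, OF r(1), of "int DIM('a)"] by (simp add: iso_def bij_betw_def)
        then show ?thesis
          by (rule inj_onD) (use *(1) c0 k in \<open>simp_all add: ib.hom_int_pow\<close>)
      qed
      have bk: "b = b0 [^]\<^bsub>homology_top ?X (U - K)\<^esub> k"
        by (rule excision_inj[OF U(1) K(2) K(1)])
           (use * b0 c0 in \<open>simp_all add: ck iK.hom_int_pow ie.hom_int_pow\<close>)
      show "induced_top ?X (U - K) euclidean (- {0}) f b =
         induced_top euclidean ?B euclidean (- {0}) id c [^]\<^bsub>?G\<^esub> d"
        unfolding k using b0 a(1) by (simp add: bk iff.hom_int_pow d G.int_pow_pow mult.commute)
    qed
    then show ?thesis ..
  qed
  have eq: "d = d'" if r: "r > 0" "r \<le> r'" "U \<subseteq> ball 0 r" "R r d" "R r' d'" for r r' d d'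
  proof -
    let ?B = "- ball (0::'a) r" and ?B' = "- ball (0::'a) r'"
    have sub: "?B' \<subseteq> ?B" "?B \<subseteq> - K" "?B \<subseteq> - {0}" using r K by auto
    obtain c0 where c0: "c0 \<in> carrier (homology_top euclidean ?B')" "induced_top euclidean ?B' euclidean (- {0}) id c0 = a"
      using top r by (meson less_le_trans)
    let ?c = "induced_top euclidean ?B' euclidean ?B id c0"
    have c: "?c \<in> carrier (homology_top euclidean ?B)" "induced_top euclidean ?B euclidean (- {0}) id ?c = a"
      "induced_top euclidean ?B euclidean (- K) id ?c = induced_top euclidean ?B' euclidean (- K) id c0"
    proof -
      show "?c \<in> carrier (homology_top euclidean ?B)" by (rule hom_induced_carrier)
      have "induced_top euclidean ?B euclidean (- {0}) id ?c = induced_top euclidean ?B' euclidean (- {0}) id c0"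
        by (rule hom_induced_id_id) (simp_all only: sub continuous_map_id)
      then show "induced_top euclidean ?B euclidean (- {0}) id ?c = a" using c0 by simp
      show "induced_top euclidean ?B euclidean (- K) id ?c = induced_top euclidean ?B' euclidean (- K) id c0"
        by (rule hom_induced_id_id) (simp_all only: sub continuous_map_id)
    qed
    obtain b where b: "b \<in> carrier (homology_top ?X (U - K))"
      "induced_top ?X (U - K) euclidean (- K) id b = induced_top euclidean ?B euclidean (- K) id ?c"
      by (rule excision_lift[OF U(1) K(2) K(1) hom_induced_carrier])
    have "a [^]\<^bsub>?G\<^esub> d = a [^]\<^bsub>?G\<^esub> d'"
      using r(4)[unfolded R_def, rule_format, OF c(1) b] r(5)[unfolded R_def, rule_format, OF c0(1) b(1)] b(2) c c0
      by simp
    then show ?thesis by (rule a(3))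
  qed
  obtain d where d: "R r0 d" using ex[OF r0] by blast
  have "R r d" if "r > 0" "U \<subseteq> ball 0 r" for r
    using ex[OF that] eq[OF r0(1) _ r0(2) d, of r] eq[OF that(1) _ that(2) _ d] by (metis linear)
  then have "degree_along f U K d" unfolding DR by blast
  moreover have "d' = d" if "degree_along f U K d'" for d'
    using that d r0 eq[OF r0(1) order_refl r0(2)] unfolding DR by blast
  ultimately show ?thesis by blast
qed

lemma closed_zero_set:
  fixes f :: "'a::euclidean_space \<Rightarrow> 'a"
  assumes "continuous_on (closure U) f" "\<And>x. x \<in> frontier U \<Longrightarrow> f x \<noteq> 0" "open U"
  shows "closed {x \<in> U. f x = 0}"
proof -
  have "{x \<in> U. f x = 0} = {x \<in> closure U. f x = 0}"
    using assms closure_subset[of U] by (auto simp: frontier_def interior_open)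
  moreover have "closed {x \<in> closure U. f x = 0}"
    using continuous_closed_preimage_constant[OF assms(1), of 0] by simp
  ultimately show ?thesis by simp
qed

lemma brouwer_degree_along:
  fixes f :: "'a::euclidean_space \<Rightarrow> 'a"
  assumes U: "open U" "bounded U" and f: "continuous_on (closure U) f" "\<And>x. x \<in> frontier U \<Longrightarrow> f x \<noteq> 0"
    and K: "closed K" "K \<subseteq> U" "{x \<in> U. f x = 0} \<subseteq> K"
  shows "degree_along f U K d \<longleftrightarrow> brouwer_degree f U = d"
proof -
  let ?Z = "{x \<in> U. f x = 0}"
  have Z: "closed ?Z" using closed_zero_set[OF f U(1)] .
  have fU: "continuous_on U f" using f(1) closure_subset continuous_on_subset by blast
  have ex: "\<exists>!d. degree_along f U ?Z d"
    by (rule degree_along_exists_unique[OF U Z _ fU]) auto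
  have "degree_along f U K d \<longleftrightarrow> degree_along f U ?Z d"
    by (rule degree_along_enlarge[OF U(1) Z K(1) K(3) K(2) fU, symmetric]) auto
  also have "\<dots> \<longleftrightarrow> brouwer_degree f U = d"
    unfolding brouwer_degree_def using theI'[OF ex] ex by (metis (no_types, lifting))
  finally show ?thesis .
qed

theorem brouwer_degree_homotopy:
  fixes h :: "real \<Rightarrow> 'a::euclidean_space \<Rightarrow> 'a"
  assumes U: "open U" "bounded U"
    and h: "continuous_on ({0..1} \<times> closure U) (\<lambda>(t, x). h t x)"
    and nz: "\<And>t x. t \<in> {0..1} \<Longrightarrow> x \<in> frontier U \<Longrightarrow> h t x \<noteq> 0"
  shows "brouwer_degree (h 0) U = brouwer_degree (h 1) U"
proof -
  let ?C = "{z \<in> {0..1::real} \<times> closure U. (\<lambda>(t, x). h t x) z = 0}"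
  have "compact ({0..1::real} \<times> closure U)" using U by (simp add: compact_Times)
  moreover have "closed ?C"
    using continuous_closed_preimage_constant[OF h, of 0] U by (simp add: closed_Times)
  ultimately have "compact (({0..1::real} \<times> closure U) \<inter> ?C)" by (rule compact_Int_closed)
  moreover have "({0..1::real} \<times> closure U) \<inter> ?C = ?C" by blast
  ultimately have "compact ?C" by simp
  then have "compact (snd ` ?C)" by (intro compact_continuous_image continuous_intros)
  then have K: "closed (snd ` ?C)" by (rule compact_imp_closed)
  have KU: "snd ` ?C \<subseteq> U"
  proof (clarsimp, rule ccontr)
    fix t x assume "h t x = 0" "0 \<le> t" "t \<le> 1" "x \<in> closure U" "x \<notin> U"
    then show False using nz[of t x] U(1) by (simp add: frontier_def interior_open)
  qed
  have zK: "x \<in> snd ` ?C" if "t \<in> {0..1}" "x \<in> U" "h t x = 0" for t x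
    using that closure_subset[of U] by (auto intro!: rev_image_eqI[of "(t, x)"])
  have ct: "continuous_on (closure U) (h t)" if "t \<in> {0..1}" for t
    using continuous_on_compose2[OF h continuous_on_Pair[OF continuous_on_const continuous_on_id], of t "closure U"] that
    by (simp add: image_subset_iff)
  have along: "degree_along (h t) U (snd ` ?C) d \<longleftrightarrow> brouwer_degree (h t) U = d" if "t \<in> {0..1}" for t d
    by (rule brouwer_degree_along[OF U ct[OF that] nz[OF that] K KU]) (use zK that in auto)
  have "homotopic_with (\<lambda>k. k \<in> (U - snd ` ?C) \<rightarrow> - {0}) (top_of_set U) euclidean (h 0) (h 1)"
    unfolding homotopic_with_def
  proof (intro exI conjI allI ballI)
    have "continuous_on ({0..1} \<times> U) (\<lambda>(t, x). h t x)"
      by (rule continuous_on_subset[OF h]) (use closure_subset in auto)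
    then show "continuous_map (prod_topology (top_of_set {0..1}) (top_of_set U)) euclidean (\<lambda>(t, x). h t x)"
      by (simp add: prod_topology_subtopology_eu)
    show "(\<lambda>x. case (t, x) of (t, x) \<Rightarrow> h t x) \<in> (U - snd ` ?C) \<rightarrow> - {0}" if "t \<in> {0..1}" for t
      using zK that by auto
  qed auto
  then have "induced_top (top_of_set U) (U - snd ` ?C) euclidean (- {0}) (h 0)
      = induced_top (top_of_set U) (U - snd ` ?C) euclidean (- {0}) (h 1)"
    by (rule homology_homotopy_axiom)
  then have "degree_along (h 0) U (snd ` ?C) d \<longleftrightarrow> degree_along (h 1) U (snd ` ?C) d" for d
    by (simp only: degree_along_def)
  then show ?thesis using along[of 0] along[of 1] by simp
qed

theorem brouwer_degree_translation:
  fixes p :: "'a::euclidean_space"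
  assumes U: "open U" "bounded U" and p: "p \<in> U"
  shows "brouwer_degree (\<lambda>x. x - p) U = 1"
proof -
  have "degree_along (\<lambda>x. x - p) U {p} 1 \<longleftrightarrow> brouwer_degree (\<lambda>x. x - p) U = 1"
    by (rule brouwer_degree_along[OF U]) (use p U in \<open>auto intro!: continuous_intros simp: frontier_def interior_open\<close>)
  moreover have "degree_along (\<lambda>x. x - p) U {p} 1"
    unfolding degree_along_def
  proof (intro allI impI ballI)
    fix r :: real and c b
    assume *: "0 < r" "U \<subseteq> ball 0 r" "c \<in> carrier (homology_top euclidean (- ball 0 r))"
      "b \<in> carrier (homology_top (top_of_set U) (U - {p}))"
      "induced_top (top_of_set U) (U - {p}) euclidean (- {p}) id b = induced_top euclidean (- ball 0 r) euclidean (- {p}) id c"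
    let ?G = "homology_top euclidean (- {0::'a})"
    interpret G: group ?G by simp
    have "induced_top (top_of_set U) (U - {p}) euclidean (- {0}) (\<lambda>x. x - p) b
       = induced_top euclidean (- {p}) euclidean (- {0}) (\<lambda>x. x - p) (induced_top (top_of_set U) (U - {p}) euclidean (- {p}) id b)"
      by (rule hom_induced_id_then[symmetric]) (auto intro!: continuous_intros)
    also have "\<dots> = induced_top euclidean (- {p}) euclidean (- {0}) (\<lambda>x. x - p) (induced_top euclidean (- ball 0 r) euclidean (- {p}) id c)"
      by (simp only: *(5))
    also have "\<dots> = induced_top euclidean (- ball 0 r) euclidean (- {0}) (\<lambda>x. x - p) c"
      by (rule hom_induced_id_then) (use * p in \<open>auto intro!: continuous_intros\<close>)
    also have "\<dots> = induced_top euclidean (- ball 0 r) euclidean (- {0}) id c"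
    proof -
      have "homotopic_with (\<lambda>k. k \<in> (- ball 0 r) \<rightarrow> - {0}) euclidean euclidean (\<lambda>x. x - p) id"
        unfolding homotopic_with_def
      proof (intro exI conjI allI ballI)
        show "continuous_map (prod_topology (top_of_set {0..1}) euclidean) euclidean (\<lambda>(t, x). x - (1 - t) *\<^sub>R p)"
          using prod_topology_subtopology_eu[of "{0..1::real}" "UNIV :: 'a set"]
          by (auto simp: case_prod_unfold intro!: continuous_intros)
        show "(\<lambda>x. case (t, x) of (t, x) \<Rightarrow> x - (1 - t) *\<^sub>R p) \<in> (- ball 0 r) \<rightarrow> - {0}" if t: "t \<in> {0..1}" for t
        proof -
          have "norm ((1 - t) *\<^sub>R p) < r"
          proof -
            have "norm ((1 - t) *\<^sub>R p) \<le> 1 * norm p" unfolding norm_scaleR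
              by (rule mult_right_mono) (use t in auto)
            also have "norm p < r" using * p by auto
            finally show ?thesis by simp
          qed
          then show ?thesis by auto
        qed
      qed auto
      then show ?thesis by (metis homology_homotopy_axiom)
    qed
    also have "\<dots> = induced_top euclidean (- ball 0 r) euclidean (- {0}) id c [^]\<^bsub>?G\<^esub> (1::int)"
      by (simp add: hom_induced_carrier)
    finally show "induced_top (top_of_set U) (U - {p}) euclidean (- {0}) (\<lambda>x. x - p) b
       = induced_top euclidean (- ball 0 r) euclidean (- {0}) id c [^]\<^bsub>?G\<^esub> (1::int)" .
  qed
  ultimately show ?thesis by simp
qed

lemma homology_separated_inj:
  fixes K1 K2 :: "'a::euclidean_space set"
  assumes K: "closed K1" "closed K2" "K1 \<inter> U2 = {}" "K2 \<subseteq> U2" "open U2"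
    and x: "x \<in> carrier (homology_top euclidean (- (K1 \<union> K2)))"
    and x1: "induced_top euclidean (- (K1 \<union> K2)) euclidean (- K1) id x = \<one>\<^bsub>homology_top euclidean (- K1)\<^esub>"
    and x2: "induced_top euclidean (- (K1 \<union> K2)) euclidean (- K2) id x = \<one>\<^bsub>homology_top euclidean (- K2)\<^esub>"
  shows "x = \<one>\<^bsub>homology_top euclidean (- (K1 \<union> K2))\<^esub>"
proof -
  let ?K = "K1 \<union> K2" and ?X = "top_of_set (- K1)"
  have "- ?K \<subseteq> - K1" by auto
  from homology_exactness_triple_3[OF this, of "int DIM('a)" euclidean]
  have "induced_top ?X (- ?K) euclidean (- ?K) id ` carrier (homology_top ?X (- ?K))
    = kernel (homology_top euclidean (- ?K)) (homology_top euclidean (- K1)) (induced_top euclidean (- ?K) euclidean (- K1) id)"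
    by (simp add: exact_seq_cons_iff)
  moreover have "x \<in> kernel (homology_top euclidean (- ?K)) (homology_top euclidean (- K1)) (induced_top euclidean (- ?K) euclidean (- K1) id)"
    using x x1 by (simp add: kernel_def)
  ultimately have "x \<in> induced_top ?X (- ?K) euclidean (- ?K) id ` carrier (homology_top ?X (- ?K))"
    by (simp only:)
  then obtain y where y: "x = induced_top ?X (- ?K) euclidean (- ?K) id y" "y \<in> carrier (homology_top ?X (- ?K))"
    by (rule imageE)
  have "U2 \<subseteq> - K1" using K by auto
  from iso_excision_nbhd[OF K(5) this K(4) K(2), of "int DIM('a)"]
  have "induced_top (top_of_set U2) (U2 - K2) ?X (- K1 - K2) id ` carrier (homology_top (top_of_set U2) (U2 - K2))
     = carrier (homology_top ?X (- K1 - K2))"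
    by (simp add: iso_def bij_betw_def)
  moreover have KK: "- K1 - K2 = - ?K" by auto
  ultimately have "y \<in> induced_top (top_of_set U2) (U2 - K2) ?X (- ?K) id ` carrier (homology_top (top_of_set U2) (U2 - K2))"
    using y(2) by (simp only:)
  then obtain z where z: "y = induced_top (top_of_set U2) (U2 - K2) ?X (- ?K) id z" "z \<in> carrier (homology_top (top_of_set U2) (U2 - K2))"
    by (rule imageE)
  have sub: "U2 - K2 \<subseteq> - ?K" "- ?K \<subseteq> - K2" "U2 \<subseteq> - K1" using K by auto
  have xz: "x = induced_top (top_of_set U2) (U2 - K2) euclidean (- ?K) id z"
    unfolding y(1) z(1)
    by (rule hom_induced_id_id) (use K in \<open>auto simp: continuous_map_in_subtopology\<close>)
  interpret i2: group_hom "homology_top (top_of_set U2) (U2 - K2)" "homology_top euclidean (- K2)" "induced_top (top_of_set U2) (U2 - K2) euclidean (- K2) id"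
    by (rule group_hom_induced)
  interpret i3: group_hom "homology_top (top_of_set U2) (U2 - K2)" "homology_top euclidean (- ?K)" "induced_top (top_of_set U2) (U2 - K2) euclidean (- ?K) id"
    by (rule group_hom_induced)
  have "induced_top euclidean (- ?K) euclidean (- K2) id x = induced_top (top_of_set U2) (U2 - K2) euclidean (- K2) id z"
    unfolding xz by (rule hom_induced_id_id) (use K in auto)
  then have "induced_top (top_of_set U2) (U2 - K2) euclidean (- K2) id z
      = induced_top (top_of_set U2) (U2 - K2) euclidean (- K2) id \<one>\<^bsub>homology_top (top_of_set U2) (U2 - K2)\<^esub>"
    using x2 i2.hom_one by (simp only:)
  then have "z = \<one>\<^bsub>homology_top (top_of_set U2) (U2 - K2)\<^esub>"
    by (rule excision_inj[OF K(5,4,2) z(2) i2.G.one_closed])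
  then show ?thesis
    unfolding xz using i3.hom_one by (simp only:)
qed

theorem brouwer_degree_additive:
  fixes f :: "'a::euclidean_space \<Rightarrow> 'a"
  assumes U: "open U" "bounded U" and Ui: "open U1" "open U2" "U1 \<inter> U2 = {}" "U1 \<union> U2 \<subseteq> U"
    and f: "continuous_on (closure U) f" and nz: "\<And>x. x \<in> closure U - (U1 \<union> U2) \<Longrightarrow> f x \<noteq> 0"
  shows "brouwer_degree f U = brouwer_degree f U1 + brouwer_degree f U2"
proof -
  define K1 K2 where "K1 = {x \<in> U1. f x = 0}" and "K2 = {x \<in> U2. f x = 0}"
  have cl: "closure U1 \<subseteq> closure U" "closure U2 \<subseteq> closure U" using Ui by (auto intro!: closure_mono)
  have bd: "bounded U1" "bounded U2" using U Ui by (auto intro: bounded_subset)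
  have f1: "continuous_on (closure U1) f" and f2: "continuous_on (closure U2) f"
    using f cl continuous_on_subset by blast+
  have fr: "frontier U1 \<subseteq> closure U - (U1 \<union> U2)" "frontier U2 \<subseteq> closure U - (U1 \<union> U2)"
    "frontier U \<subseteq> closure U - (U1 \<union> U2)"
    using cl Ui open_Int_closure_eq_empty[OF Ui(2), of U1] open_Int_closure_eq_empty[OF Ui(1), of U2] U
    by (auto simp: frontier_def interior_open)
  have nf1: "f x \<noteq> 0" if "x \<in> frontier U1" for x using fr that nz by blast
  have nf2: "f x \<noteq> 0" if "x \<in> frontier U2" for x using fr that nz by blast
  have nf: "f x \<noteq> 0" if "x \<in> frontier U" for x using fr that nz by blast
  have c1: "closed K1" unfolding K1_def by (rule closed_zero_set[OF f1 nf1 Ui(1)])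
  have c2: "closed K2" unfolding K2_def by (rule closed_zero_set[OF f2 nf2 Ui(2)])
  have KU: "K1 \<subseteq> U1" "K2 \<subseteq> U2" "K1 \<union> K2 \<subseteq> U" "K1 \<inter> U2 = {}" "K2 \<inter> U1 = {}" using Ui by (auto simp: K1_def K2_def)
  have zK: "{x \<in> U. f x = 0} \<subseteq> K1 \<union> K2" using nz closure_subset[of U] by (auto simp: K1_def K2_def)
  define d1 d2 where "d1 = brouwer_degree f U1" and "d2 = brouwer_degree f U2"
  have D1: "degree_along f U1 K1 d1"
    using brouwer_degree_along[OF Ui(1) bd(1) f1 nf1 c1 KU(1)] by (auto simp: K1_def d1_def)
  have D2: "degree_along f U2 K2 d2"
    using brouwer_degree_along[OF Ui(2) bd(2) f2 nf2 c2 KU(2)] by (auto simp: K2_def d2_def)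
  let ?K = "K1 \<union> K2" and ?X = "top_of_set U" and ?X1 = "top_of_set U1" and ?X2 = "top_of_set U2"
  have cK: "closed ?K" using c1 c2 by (rule closed_Un)
  have fU: "continuous_on U f" using f closure_subset continuous_on_subset by blast
  have "degree_along f U ?K (d1 + d2)"
    unfolding degree_along_def
  proof (intro allI impI ballI)
    fix r :: real and c b
    let ?B = "- ball (0::'a) r" and ?N = "- {0::'a}"
    let ?c0 = "induced_top euclidean ?B euclidean ?N id c"
    assume *: "0 < r" "U \<subseteq> ball 0 r" "c \<in> carrier (homology_top euclidean ?B)"
      "b \<in> carrier (homology_top ?X (U - ?K))"
      "induced_top ?X (U - ?K) euclidean (- ?K) id b = induced_top euclidean ?B euclidean (- ?K) id c"
    have Ur: "U1 \<subseteq> ball 0 r" "U2 \<subseteq> ball 0 r" using * Ui by auto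
    obtain b1 where b1: "b1 \<in> carrier (homology_top ?X1 (U1 - K1))"
      "induced_top ?X1 (U1 - K1) euclidean (- K1) id b1 = induced_top euclidean ?B euclidean (- K1) id c"
      by (rule excision_lift[OF Ui(1) KU(1) c1 hom_induced_carrier])
    obtain b2 where b2: "b2 \<in> carrier (homology_top ?X2 (U2 - K2))"
      "induced_top ?X2 (U2 - K2) euclidean (- K2) id b2 = induced_top euclidean ?B euclidean (- K2) id c"
      by (rule excision_lift[OF Ui(2) KU(2) c2 hom_induced_carrier])
    have e1: "induced_top ?X1 (U1 - K1) euclidean ?N f b1 = ?c0 [^]\<^bsub>homology_top euclidean ?N\<^esub> d1"
      using D1[unfolded degree_along_def, rule_format, OF *(1) Ur(1) *(3) b1] .
    have e2: "induced_top ?X2 (U2 - K2) euclidean ?N f b2 = ?c0 [^]\<^bsub>homology_top euclidean ?N\<^esub> d2"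
      using D2[unfolded degree_along_def, rule_format, OF *(1) Ur(2) *(3) b2] .
    let ?HK = "homology_top euclidean (- ?K)" and ?HX = "homology_top ?X (U - ?K)"
    define \<beta>1 where "\<beta>1 = induced_top ?X1 (U1 - K1) ?X (U - ?K) id b1"
    define \<beta>2 where "\<beta>2 = induced_top ?X2 (U2 - K2) ?X (U - ?K) id b2"
    define g where "g = induced_top euclidean ?B euclidean (- ?K) id c"
    define g1 where "g1 = induced_top ?X1 (U1 - K1) euclidean (- ?K) id b1"
    define g2 where "g2 = induced_top ?X2 (U2 - K2) euclidean (- ?K) id b2"
    have sub: "U1 - K1 \<subseteq> U - ?K" "U2 - K2 \<subseteq> U - ?K" "U - ?K \<subseteq> - ?K" "?B \<subseteq> - ?K" "- ?K \<subseteq> - K1" "- ?K \<subseteq> - K2"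
      "U1 - K1 \<subseteq> - ?K" "U2 - K2 \<subseteq> - ?K" "U1 \<subseteq> U" "U2 \<subseteq> U"
      using Ui KU * by auto
    have fim: "f ` (U - ?K) \<subseteq> ?N" using zK by auto
    have cm: "continuous_map ?X1 ?X id" "continuous_map ?X2 ?X id" "continuous_map ?X euclidean id"
      "continuous_map ?X1 euclidean id" "continuous_map ?X2 euclidean id" "continuous_map ?X euclidean f"
      using sub fU by (auto simp: continuous_map_in_subtopology)
    have gc: "g \<in> carrier ?HK" "g1 \<in> carrier ?HK" "g2 \<in> carrier ?HK"
      unfolding g_def g1_def g2_def by (rule hom_induced_carrier)+
    have bc: "\<beta>1 \<in> carrier ?HX" "\<beta>2 \<in> carrier ?HX"
      unfolding \<beta>1_def \<beta>2_def by (rule hom_induced_carrier)+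
    note Compl_Un [simp del] compl_sup [simp del] one_relative_homology_group [simp del]
    interpret HK: comm_group ?HK by simp
    interpret HX: group ?HX by simp
    interpret HN: group "homology_top euclidean ?N" by simp
    interpret r1: group_hom ?HK "homology_top euclidean (- K1)" "induced_top euclidean (- ?K) euclidean (- K1) id"
      by (rule group_hom_induced)
    interpret r2: group_hom ?HK "homology_top euclidean (- K2)" "induced_top euclidean (- ?K) euclidean (- K2) id"
      by (rule group_hom_induced)
    interpret e: group_hom ?HX ?HK "induced_top ?X (U - ?K) euclidean (- ?K) id"
      by (rule group_hom_induced)
    interpret ff: group_hom ?HX "homology_top euclidean ?N" "induced_top ?X (U - ?K) euclidean ?N f"
      by (rule group_hom_induced)
    have eb1: "induced_top ?X (U - ?K) euclidean (- ?K) id \<beta>1 = g1"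
      unfolding \<beta>1_def g1_def by (rule hom_induced_id_id[OF cm(1,3) sub(1,3)])
    have eb2: "induced_top ?X (U - ?K) euclidean (- ?K) id \<beta>2 = g2"
      unfolding \<beta>2_def g2_def by (rule hom_induced_id_id[OF cm(2,3) sub(2,3)])
    have fb1: "induced_top ?X (U - ?K) euclidean ?N f \<beta>1 = ?c0 [^]\<^bsub>homology_top euclidean ?N\<^esub> d1"
      unfolding \<beta>1_def e1[symmetric] by (rule hom_induced_id_then[OF cm(1,6) sub(1) fim])
    have fb2: "induced_top ?X (U - ?K) euclidean ?N f \<beta>2 = ?c0 [^]\<^bsub>homology_top euclidean ?N\<^esub> d2"
      unfolding \<beta>2_def e2[symmetric] by (rule hom_induced_id_then[OF cm(2,6) sub(2) fim])
    let ?q1 = "induced_top euclidean (- ?K) euclidean (- K1) id" and ?q2 = "induced_top euclidean (- ?K) euclidean (- K2) id"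
    have q1: "?q1 g = induced_top euclidean ?B euclidean (- K1) id c" "?q1 g1 = induced_top euclidean ?B euclidean (- K1) id c"
    proof -
      show "?q1 g = induced_top euclidean ?B euclidean (- K1) id c"
        unfolding g_def by (rule hom_induced_id_id[OF _ _ sub(4,5)]) simp_all
      show "?q1 g1 = induced_top euclidean ?B euclidean (- K1) id c"
        unfolding g1_def b1(2)[symmetric] by (rule hom_induced_id_id[OF cm(4) _ sub(7,5)]) simp
    qed
    have q2: "?q2 g = induced_top euclidean ?B euclidean (- K2) id c" "?q2 g2 = induced_top euclidean ?B euclidean (- K2) id c"
    proof -
      show "?q2 g = induced_top euclidean ?B euclidean (- K2) id c"
        unfolding g_def by (rule hom_induced_id_id[OF _ _ sub(4,6)]) simp_all
      show "?q2 g2 = induced_top euclidean ?B euclidean (- K2) id c"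
        unfolding g2_def b2(2)[symmetric] by (rule hom_induced_id_id[OF cm(5) _ sub(8,6)]) simp
    qed
    have triv: "induced_top (top_of_set V) (V - L) euclidean (- M) id y = \<one>\<^bsub>homology_top euclidean (- M)\<^esub>"
      if "V \<inter> M = {}" for V L M :: "'a set" and y
    proof -
      interpret t: group_hom "homology_top (top_of_set V) V" "homology_top euclidean (- M)" "induced_top (top_of_set V) V euclidean (- M) id"
        by (rule group_hom_induced)
      have "trivial_group (homology_top (top_of_set V) V)"
        using trivial_relative_homology_group_topspace[of "int DIM('a)" "top_of_set V"] by simp
      then have "induced_top (top_of_set V) (V - L) (top_of_set V) V id y = \<one>\<^bsub>homology_top (top_of_set V) V\<^esub>"
        using hom_induced_carrier[of "int DIM('a)" "top_of_set V" "V - L" "top_of_set V" V id y]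
        by (simp add: trivial_group_def)
      moreover have "induced_top (top_of_set V) V euclidean (- M) id (induced_top (top_of_set V) (V - L) (top_of_set V) V id y)
          = induced_top (top_of_set V) (V - L) euclidean (- M) id y"
        by (rule hom_induced_id_id) (use that in auto)
      ultimately show ?thesis using t.hom_one by simp
    qed
    have t1: "?q1 g2 = \<one>\<^bsub>homology_top euclidean (- K1)\<^esub>"
    proof -
      have "?q1 g2 = induced_top ?X2 (U2 - K2) euclidean (- K1) id b2"
        unfolding g2_def by (rule hom_induced_id_id[OF cm(5) _ sub(8,5)]) simp
      then show ?thesis using triv[of U2 K1 K2 b2] KU by (simp add: Int_commute)
    qed
    have t2: "?q2 g1 = \<one>\<^bsub>homology_top euclidean (- K2)\<^esub>"
    proof -
      have "?q2 g1 = induced_top ?X1 (U1 - K1) euclidean (- K2) id b1"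
        unfolding g1_def by (rule hom_induced_id_id[OF cm(4) _ sub(7,6)]) simp
      then show ?thesis using triv[of U1 K2 K1 b1] KU by (simp add: Int_commute)
    qed
    let ?x = "g \<otimes>\<^bsub>?HK\<^esub> inv\<^bsub>?HK\<^esub> (g1 \<otimes>\<^bsub>?HK\<^esub> g2)"
    have "?x = \<one>\<^bsub>?HK\<^esub>"
    proof (rule homology_separated_inj[OF c1 c2 KU(4,2) Ui(2)])
      show "?x \<in> carrier ?HK" using gc by simp
      show "?q1 ?x = \<one>\<^bsub>homology_top euclidean (- K1)\<^esub>"
        using gc q1 t1 r1.hom_closed[OF gc(1)] by simp
      show "?q2 ?x = \<one>\<^bsub>homology_top euclidean (- K2)\<^esub>"
        using gc q2 t2 r2.hom_closed[OF gc(1)] by simp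
    qed
    then have "g = g1 \<otimes>\<^bsub>?HK\<^esub> g2"
      using gc by (metis HK.inv_closed HK.inv_equality HK.inv_inv HK.m_closed)
    then have "b = \<beta>1 \<otimes>\<^bsub>?HX\<^esub> \<beta>2"
      by (intro excision_inj[OF U(1) KU(3) cK *(4)]) (use bc *(5) in \<open>simp_all add: eb1 eb2 g_def\<close>)
    then show "induced_top ?X (U - ?K) euclidean ?N f b = ?c0 [^]\<^bsub>homology_top euclidean ?N\<^esub> (d1 + d2)"
      using bc by (simp add: fb1 fb2 HN.int_pow_mult hom_induced_carrier)
  qed
  then show ?thesis
    using brouwer_degree_along[OF U f nf cK KU(3) zK] by (simp add: d1_def d2_def)
qed

section \<open>Differential equations\<close>

text \<open>
  A solution on \<open>{0..T}\<close>, with one-sided derivatives at the end points.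
\<close>

definition ode_solution ::
  "(real \<Rightarrow> 'a \<Rightarrow> 'a::real_normed_vector) \<Rightarrow> real \<Rightarrow> real \<Rightarrow> 'a \<Rightarrow> (real \<Rightarrow> 'a) \<Rightarrow> bool"
  where "ode_solution F T t0 \<xi> x \<longleftrightarrow>
    x t0 = \<xi> \<and> (\<forall>t\<in>{0..T}. (x has_vector_derivative F t (x t)) (at t within {0..T}))"

text \<open>
  The description is over the value at \<open>t\<close>, not over the function, because the latter is arbitrary
  outside \<open>{0..T}\<close>.
\<close>

definition ode_value ::
  "(real \<Rightarrow> 'a \<Rightarrow> 'a::real_normed_vector) \<Rightarrow> real \<Rightarrow> real \<Rightarrow> 'a \<Rightarrow> real \<Rightarrow> 'a"
  where "ode_value F T t0 \<xi> t = (THE v. \<exists>x. ode_solution F T t0 \<xi> x \<and> x t = v)"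

definition continuously_differentiable ::
  "('a::real_normed_vector \<Rightarrow> 'b::real_normed_vector) \<Rightarrow> bool"
  where "continuously_differentiable F \<longleftrightarrow>
    (\<exists>F'. (\<forall>p. (F has_derivative blinfun_apply (F' p)) (at p)) \<and> continuous_on UNIV F')"

definition perturbed_field ::
  "(real \<Rightarrow> 'a \<Rightarrow> 'a::real_normed_vector) \<Rightarrow> (real \<Rightarrow> 'a \<Rightarrow> real \<Rightarrow> 'a) \<Rightarrow> real \<Rightarrow> real \<Rightarrow> 'a \<Rightarrow> 'a"
  where "perturbed_field f g \<epsilon> t x = f t x + \<epsilon> *\<^sub>R g t x \<epsilon>"

definition poincare_map ::
  "(real \<Rightarrow> 'a \<Rightarrow> 'a::real_normed_vector) \<Rightarrow> (real \<Rightarrow> 'a \<Rightarrow> real \<Rightarrow> 'a) \<Rightarrow> real \<Rightarrow> real \<Rightarrow> 'a \<Rightarrow> 'a"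
  where "poincare_map f g T \<epsilon> \<xi> = ode_value (perturbed_field f g \<epsilon>) T 0 \<xi> T"

definition linearized_field ::
  "(real \<Rightarrow> 'a \<Rightarrow> 'a::real_normed_vector) \<Rightarrow> (real \<Rightarrow> 'a \<Rightarrow> real \<Rightarrow> 'a) \<Rightarrow> real \<Rightarrow> 'a \<Rightarrow> real \<Rightarrow> 'a \<Rightarrow> 'a"
  where "linearized_field f g T \<xi> t y =
    frechet_derivative (f t) (at (ode_value f T 0 \<xi> t)) y + g t (ode_value f T 0 \<xi> t) 0"

definition averaging_operator ::
  "(real \<Rightarrow> 'a \<Rightarrow> 'a::real_normed_vector) \<Rightarrow> (real \<Rightarrow> 'a \<Rightarrow> real \<Rightarrow> 'a) \<Rightarrow> real \<Rightarrow> real \<Rightarrow> 'a \<Rightarrow> 'a"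
  where "averaging_operator f g T s \<xi> =
    ode_value (linearized_field f g T \<xi>) T s 0 T - ode_value (linearized_field f g T \<xi>) T s 0 0"

end

theory Submission
  imports Defs "HOL-Complex_Analysis.Great_Picard"
begin

text \<open>
On the boundary of \<open>U\<close> the unperturbed translation operator is the identity, so there
\<open>P\<^sub>\<epsilon>(\<xi>) - \<xi> = P\<^sub>\<epsilon>(\<xi>) - P\<^sub>0(\<xi>)\<close>. To first order this is \<open>\<epsilon>\<close> times the derivative of the solution
with respect to \<open>\<epsilon>\<close> at \<open>\<epsilon> = 0\<close>, which is \<open>\<eta>(T, 0, \<xi>) = \<Phi>\<^sup>0(\<xi>)\<close>. As \<open>\<Phi>\<^sup>0\<close> has no zero on the compact
boundary, for small \<open>\<epsilon>\<close> the vector \<open>P\<^sub>\<epsilon>(\<xi>) - \<xi>\<close> has a positive inner product with \<open>\<Phi>\<^sup>0(\<xi>)\<close>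
(\<open>boundary_alignment\<close>). Hence \<open>P\<^sub>\<epsilon>\<close> has no fixed point on the boundary, and a straight-line homotopy
gives \<open>I - P\<^sub>\<epsilon>\<close> the degree of \<open>-\<Phi>\<^sup>0\<close>. The operators \<open>-\<Phi>\<^sup>s\<close> with \<open>0 \<le> s \<le> T\<close> form a second homotopy,
from \<open>-\<Phi>\<^sup>0\<close> to \<open>-\<Phi>\<^sup>T\<close> (\<open>degree_perturbed_flow\<close>).

The analytic part is that everything in sight is continuous although \<open>g\<close> is merely continuous, so that
no Lipschitz estimate for the perturbed equation is available. It is replaced by compactness: bounded
solutions of a convergent family of equations have a subsequence converging to a solution of the limit
equation (\<open>ode_solutions_subsequence\<close>), and if the limit problem has only one solution on every
\<open>{0..\<tau>}\<close>, the solutions cannot escape and converge as a whole (\<open>ode_solutions_uniform_limit\<close>). This one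
result is used three times: for the continuity of \<open>\<Omega>\<close>, for that of \<open>P\<^sub>\<epsilon>\<close>, and for the expansion in
\<open>\<epsilon>\<close>. The last use works because the scaled deviation
\<open>w = (x\<^sub>\<epsilon> - \<Omega>) / \<epsilon>\<close> itself solves a differential equation that depends continuously on \<open>\<epsilon>\<close> down to
\<open>\<epsilon> = 0\<close>, where it is the linearized equation. To see this, write
\<open>f(t, x + h) - f(t, x) = H(t, x, h) h\<close> with a continuous operator-valued \<open>H\<close> (\<open>hadamard_quotient\<close>).
\<close>

section \<open>Convergence of sequences and a mean value bound\<close>

lemma tendsto_sub_subsequenceI:
  fixes X :: "nat \<Rightarrow> 'a::metric_space"
  assumes "\<And>r :: nat \<Rightarrow> nat. strict_mono r \<Longrightarrow> \<exists>r' :: nat \<Rightarrow> nat. strict_mono r' \<and> (\<lambda>k. X (r (r' k))) \<longlonglongrightarrow> l"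
  shows "X \<longlonglongrightarrow> l"
proof (rule ccontr)
  assume "\<not> X \<longlonglongrightarrow> l"
  then obtain e where e: "e > 0" "\<not> (\<forall>\<^sub>F k in sequentially. dist (X k) l < e)"
    by (auto simp: tendsto_iff)
  then have "infinite {k. \<not> dist (X k) l < e}"
    by (simp add: cofinite_eq_sequentially[symmetric] eventually_cofinite)
  then obtain r :: "nat \<Rightarrow> nat" where r: "strict_mono r" "\<forall>k. r k \<in> {k. \<not> dist (X k) l < e}"
    using infinite_enumerate by blast
  obtain r' :: "nat \<Rightarrow> nat" where "(\<lambda>k. X (r (r' k))) \<longlonglongrightarrow> l"
    using assms[OF r(1)] by blast
  then have "\<forall>\<^sub>F k in sequentially. dist (X (r (r' k))) l < e"
    using e(1) by (rule tendstoD)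
  then show False
    using r(2) by (auto simp: eventually_sequentially)
qed

lemma tendsto_uniform_limit_moving:
  fixes f :: "nat \<Rightarrow> 'a::topological_space \<Rightarrow> 'b::metric_space"
  assumes u: "uniform_limit S f l sequentially" and c: "continuous_on S l"
    and x: "\<And>k. x k \<in> S" "a \<in> S" "x \<longlonglongrightarrow> a"
  shows "(\<lambda>k. f k (x k)) \<longlonglongrightarrow> l a"
proof (rule tendstoI)
  fix e :: real assume e: "e > 0"
  have "(\<lambda>k. l (x k)) \<longlonglongrightarrow> l a"
    by (rule continuous_on_tendsto_compose[OF c x(3,2)]) (use x in auto)
  then have "\<forall>\<^sub>F k in sequentially. dist (l (x k)) (l a) < e / 2"
    using e by (intro tendstoD) auto
  moreover have "\<forall>\<^sub>F k in sequentially. \<forall>y\<in>S. dist (f k y) (l y) < e / 2"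
    using e by (intro uniform_limitD[OF u]) auto
  ultimately show "\<forall>\<^sub>F k in sequentially. dist (f k (x k)) (l a) < e"
  proof eventually_elim
    case (elim k)
    then have "dist (f k (x k)) (l (x k)) < e / 2" using x by blast
    then show ?case using elim dist_triangle[of "f k (x k)" "l a" "l (x k)"] by linarith
  qed
qed

lemma compact_continuous_norm_bound:
  fixes f :: "'a::topological_space \<Rightarrow> 'b::real_normed_vector"
  assumes "compact S" "continuous_on S f"
  obtains B where "B > 0" "\<And>x. x \<in> S \<Longrightarrow> norm (f x) \<le> B"
  using compact_imp_bounded[OF compact_continuous_image[OF assms(2,1)]] by (auto simp: bounded_pos)

text \<open>
The one-dimensional form of termwise differentiation; it makes it possible to pass to the limit in a
differential equation without rewriting it as an integral equation.
\<close>

lemma has_vector_derivative_uniform_limit: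
  fixes x :: "nat \<Rightarrow> real \<Rightarrow> 'a::banach"
  assumes x: "\<And>n t. t \<in> {a..b} \<Longrightarrow> (x n has_vector_derivative x' n t) (at t within {a..b})"
    and x': "uniform_limit {a..b} x' y' sequentially"
    and y: "\<And>t. t \<in> {a..b} \<Longrightarrow> (\<lambda>n. x n t) \<longlonglongrightarrow> y t"
    and t: "t \<in> {a..b}"
  shows "(y has_vector_derivative y' t) (at t within {a..b})"
proof -
  have "\<exists>g. \<forall>u\<in>{a..b}. (\<lambda>n. x n u) \<longlonglongrightarrow> g u \<and> (g has_derivative (\<lambda>h. h *\<^sub>R y' u)) (at u within {a..b})"
  proof (rule has_derivative_sequence)
    show "\<And>n u. u \<in> {a..b} \<Longrightarrow> (x n has_derivative (\<lambda>h. h *\<^sub>R x' n u)) (at u within {a..b})"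
      using x by (simp add: has_vector_derivative_def)
    show "\<forall>\<^sub>F n in sequentially. \<forall>u\<in>{a..b}. \<forall>h. norm (h *\<^sub>R x' n u - h *\<^sub>R y' u) \<le> e * norm h"
      if "e > 0" for e
      using uniform_limitD[OF x' that]
    proof eventually_elim
      case (elim n)
      have "norm (h *\<^sub>R x' n u - h *\<^sub>R y' u) \<le> e * norm h" if "u \<in> {a..b}" for u h
      proof -
        have "norm (h *\<^sub>R x' n u - h *\<^sub>R y' u) = norm (x' n u - y' u) * norm h"
          by (simp flip: scaleR_diff_right)
        also have "\<dots> \<le> e * norm h"
          using elim that by (intro mult_right_mono) (auto simp: dist_norm less_imp_le)
        finally show ?thesis .
      qed
      then show ?case by blast
    qed
    show "(\<lambda>n. x n t) \<longlonglongrightarrow> y t" using y t by blast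
  qed (use t in auto)
  then obtain g where g: "\<And>u. u \<in> {a..b} \<Longrightarrow> (\<lambda>n. x n u) \<longlonglongrightarrow> g u"
    "(g has_derivative (\<lambda>h. h *\<^sub>R y' t)) (at t within {a..b})"
    using t by blast
  have "g u = y u" if "u \<in> {a..b}" for u
    using g(1)[OF that] y[OF that] by (rule LIMSEQ_unique)
  then show ?thesis
    using g(2) t unfolding has_vector_derivative_def by (metis has_derivative_transform)
qed

lemma vector_derivative_norm_bound:
  fixes z :: "real \<Rightarrow> 'a::real_normed_vector"
  assumes z: "\<And>t. t \<in> {a..b} \<Longrightarrow> (z has_vector_derivative z' t) (at t within {a..b})"
    and \<phi>: "\<And>t. t \<in> {a..b} \<Longrightarrow> (\<phi> has_real_derivative \<phi>' t) (at t within {a..b})"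
    and le: "\<And>t. t \<in> {a..b} \<Longrightarrow> norm (z' t) \<le> \<phi>' t" and ab: "a \<le> b"
  shows "norm (z b - z a) \<le> \<phi> b - \<phi> a"
proof (cases "a = b")
  case False
  then have "a < b" using ab by simp
  then show ?thesis
  proof (rule differentiable_bound_general)
    show "continuous_on {a..b} z"
      using z has_vector_derivative_continuous continuous_on_eq_continuous_within by blast
    show "continuous_on {a..b} \<phi>" using \<phi> by (rule DERIV_continuous_on)
    fix t assume t: "a < t" "t < b"
    then have at: "at t within {a..b} = at t" by (intro at_within_interior) auto
    show "(z has_vector_derivative z' t) (at t)" "(\<phi> has_vector_derivative \<phi>' t) (at t)"
      using z[of t] \<phi>[of t] t by (auto simp: at has_real_derivative_iff_has_vector_derivative)
    show "norm (z' t) \<le> \<phi>' t" using le t by auto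
  qed
qed simp

section \<open>Solutions on an interval\<close>

lemma ode_solution_continuous_on:
  assumes "ode_solution F T t0 \<xi> x"
  shows "continuous_on {0..T} x"
  using assms has_vector_derivative_continuous continuous_on_eq_continuous_within
  unfolding ode_solution_def by blast

lemma ode_solution_cong:
  assumes "ode_solution F T t0 \<xi> x" "t0 \<in> {0..T}" "\<And>t. t \<in> {0..T} \<Longrightarrow> y t = x t"
    "\<And>t. t \<in> {0..T} \<Longrightarrow> G t (x t) = F t (x t)"
  shows "ode_solution G T t0 \<xi> y"
proof -
  have "(y has_vector_derivative G t (y t)) (at t within {0..T})" if "t \<in> {0..T}" for t
  proof (rule has_vector_derivative_transform[OF that])
    show "\<And>u. u \<in> {0..T} \<Longrightarrow> y u = x u" by (rule assms(3))
    show "(x has_vector_derivative G t (y t)) (at t within {0..T})"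
      using assms that by (simp add: ode_solution_def)
  qed
  then show ?thesis using assms by (simp add: ode_solution_def)
qed

lemma ode_value_eq:
  assumes "ode_solution F T t0 \<xi> x" "\<And>y. ode_solution F T t0 \<xi> y \<Longrightarrow> y t = x t"
  shows "ode_value F T t0 \<xi> t = x t"
  unfolding ode_value_def by (rule the_equality) (use assms in blast)+

lemma ode_solution_restrict:
  assumes x: "ode_solution F T 0 \<xi> x" and \<tau>: "\<tau> \<in> {0..T}"
  shows "ode_solution F \<tau> 0 \<xi> x"
  using x \<tau> has_vector_derivative_within_subset[of x _ _ "{0..T}" "{0..\<tau>}"]
  by (auto simp: ode_solution_def)

text \<open>
Stretching time maps solutions on the varying intervals \<open>{0..\<tau>}\<close> to solutions on the fixed interval
\<open>{0..1}\<close>, with \<open>\<tau>\<close> as a parameter of the field. This reduces a sequence of solutions stopped at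
different times to the situation of a common interval.
\<close>

lemma ode_solution_rescale:
  assumes x: "ode_solution F T 0 \<xi> x" and \<tau>: "\<tau> \<in> {0..T}"
  shows "ode_solution (\<lambda>t v. \<tau> *\<^sub>R F (\<tau> * t) v) 1 0 \<xi> (\<lambda>t. x (\<tau> * t))"
  unfolding ode_solution_def
proof (intro conjI ballI)
  show "x (\<tau> * 0) = \<xi>" using x by (simp add: ode_solution_def)
  fix t :: real assume t: "t \<in> {0..1}"
  have "\<tau> * t \<le> T" if "t \<in> {0..1}" for t
    using mult_left_le[of t \<tau>] that \<tau> by auto
  then have sub: "(\<lambda>t. \<tau> * t) ` {0..1} \<subseteq> {0..T}" using \<tau> by auto
  have "(x has_vector_derivative F (\<tau> * t) (x (\<tau> * t))) (at (\<tau> * t) within (\<lambda>t. \<tau> * t) ` {0..1})"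
  proof (rule has_vector_derivative_within_subset[OF _ sub])
    have "\<tau> * t \<in> {0..T}" using sub t by blast
    then show "(x has_vector_derivative F (\<tau> * t) (x (\<tau> * t))) (at (\<tau> * t) within {0..T})"
      using x unfolding ode_solution_def by blast
  qed
  moreover have "((\<lambda>t. \<tau> * t) has_vector_derivative \<tau>) (at t within {0..1})"
    by (auto intro!: derivative_eq_intros simp: has_vector_derivative_def)
  ultimately show "((\<lambda>t. x (\<tau> * t)) has_vector_derivative \<tau> *\<^sub>R F (\<tau> * t) (x (\<tau> * t))) (at t within {0..1})"
    using vector_diff_chain_within[of "\<lambda>t. \<tau> * t" \<tau> t "{0..1}" x] by (simp add: o_def)
qed

lemma ode_solution_unrescale:
  assumes y: "ode_solution (\<lambda>t v. \<tau> *\<^sub>R F (\<tau> * t) v) 1 0 \<xi> y" and \<tau>: "\<tau> > 0"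
  shows "ode_solution F \<tau> 0 \<xi> (\<lambda>t. y (t / \<tau>))"
  unfolding ode_solution_def
proof (intro conjI ballI)
  show "y (0 / \<tau>) = \<xi>" using y by (simp add: ode_solution_def)
  fix t :: real assume t: "t \<in> {0..\<tau>}"
  have sub: "(\<lambda>t. t / \<tau>) ` {0..\<tau>} \<subseteq> {0..1}" using \<tau> by auto
  have "(y has_vector_derivative \<tau> *\<^sub>R F (\<tau> * (t / \<tau>)) (y (t / \<tau>))) (at (t / \<tau>) within (\<lambda>t. t / \<tau>) ` {0..\<tau>})"
  proof (rule has_vector_derivative_within_subset[OF _ sub])
    have "t / \<tau> \<in> {0..1}" using sub t by blast
    then show "(y has_vector_derivative \<tau> *\<^sub>R F (\<tau> * (t / \<tau>)) (y (t / \<tau>))) (at (t / \<tau>) within {0..1})"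
      using y unfolding ode_solution_def by blast
  qed
  moreover have "((\<lambda>t. t / \<tau>) has_vector_derivative 1 / \<tau>) (at t within {0..\<tau>})"
    using \<tau> by (auto intro!: derivative_eq_intros simp: has_vector_derivative_def)
  ultimately show "((\<lambda>t. y (t / \<tau>)) has_vector_derivative F t (y (t / \<tau>))) (at t within {0..\<tau>})"
    using vector_diff_chain_within[of "\<lambda>t. t / \<tau>" "1 / \<tau>" t "{0..\<tau>}" y "\<tau> *\<^sub>R F (\<tau> * (t / \<tau>)) (y (t / \<tau>))"] \<tau>
    by (simp add: o_def)
qed

lemma ode_solution_glue:
  assumes z: "ode_solution F \<tau> 0 \<xi> z" and u: "ode_solution F T \<tau> (z \<tau>) u" and \<tau>: "\<tau> \<in> {0..T}"
  shows "ode_solution F T 0 \<xi> (\<lambda>t. if t \<in> {0..\<tau>} then z t else u t)"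
proof -
  let ?w = "\<lambda>t. if t \<in> {0..\<tau>} then z t else u t"
  have "(?w has_vector_derivative (if t \<in> {0..\<tau>} then F t (z t) else F t (u t))) (at t within {0..T})"
    if t: "t \<in> {0..T}" for t
  proof (rule has_vector_derivative_If_within_closures[where T = "{\<tau>..T}" and f' = "\<lambda>t. F t (z t)" and g' = "\<lambda>t. F t (u t)"])
    have Int: "{0..\<tau>} \<union> closure {0..\<tau>} \<inter> closure {\<tau>..T} = {0..\<tau>}" "{\<tau>..T} \<union> closure {0..\<tau>} \<inter> closure {\<tau>..T} = {\<tau>..T}"
      and cl: "closure {0..\<tau>} \<inter> closure {\<tau>..T} = {\<tau>}"
      using \<tau> by auto
    show "(z has_vector_derivative F t (z t)) (at t within {0..\<tau>} \<union> closure {0..\<tau>} \<inter> closure {\<tau>..T})"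
      if "t \<in> {0..\<tau>} \<union> closure {0..\<tau>} \<inter> closure {\<tau>..T}"
      using z that unfolding Int ode_solution_def by blast
    show "(u has_vector_derivative F t (u t)) (at t within {\<tau>..T} \<union> closure {0..\<tau>} \<inter> closure {\<tau>..T})"
      if "t \<in> {\<tau>..T} \<union> closure {0..\<tau>} \<inter> closure {\<tau>..T}"
      unfolding Int
    proof (rule has_vector_derivative_within_subset)
      show "(u has_vector_derivative F t (u t)) (at t within {0..T})"
        using u t by (simp add: ode_solution_def)
    qed (use \<tau> in auto)
    have u\<tau>: "u \<tau> = z \<tau>" using u by (simp add: ode_solution_def)
    show "z t = u t" "F t (z t) = F t (u t)" if "t \<in> closure {0..\<tau>}" "t \<in> closure {\<tau>..T}"
    proof -
      have "t = \<tau>" using that cl by blast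
      then show "z t = u t" "F t (z t) = F t (u t)" using u\<tau> by simp_all
    qed
  qed (use t \<tau> in auto)
  then show ?thesis
    using z \<tau> by (auto simp: ode_solution_def if_distrib[of "F _"])
qed

text \<open>
A solution on \<open>{0..\<tau>}\<close> can be prolonged by some solution through its end point, so uniqueness on the
whole of \<open>{0..T}\<close> implies uniqueness on each initial part.
\<close>

lemma ode_unique_before:
  assumes ex: "\<And>t0 \<xi>. t0 \<in> {0..T} \<Longrightarrow> \<exists>x. ode_solution F T t0 \<xi> x"
    and uniq: "\<And>z. ode_solution F T 0 \<xi> z \<Longrightarrow> z \<tau> = y \<tau>"
    and \<tau>: "\<tau> \<in> {0..T}" and z: "ode_solution F \<tau> 0 \<xi> z"
  shows "z \<tau> = y \<tau>"
proof -
  obtain u where "ode_solution F T \<tau> (z \<tau>) u" using ex[OF \<tau>] by blast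
  from uniq[OF ode_solution_glue[OF z this \<tau>]] show ?thesis using \<tau> by simp
qed

section \<open>Continuous dependence on parameters and initial values\<close>

text \<open>
The fields are bounded by a common \<open>M\<close> on the compact set in which the graphs of the solutions lie,
so the solutions are \<open>M\<close>-Lipschitz and the theorem of Arzela and Ascoli gives a uniform limit. The
right-hand sides then converge uniformly as well, because the field is uniformly continuous on that set.
\<close>

lemma ode_solutions_subsequence:
  fixes F :: "'p::heine_borel \<Rightarrow> real \<Rightarrow> 'a::euclidean_space \<Rightarrow> 'a"
  assumes F: "continuous_on (P \<times> {0..T} \<times> UNIV) (\<lambda>(p, t, v). F p t v)"
    and p: "\<And>k. p k \<in> P" "q \<in> P" "p \<longlonglongrightarrow> q"
    and s: "\<And>k. s k \<in> {0..T}" "s \<longlonglongrightarrow> s'" and \<xi>: "\<xi> \<longlonglongrightarrow> \<xi>'"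
    and x: "\<And>k. ode_solution (F (p k)) T (s k) (\<xi> k) (x k)"
    and bd: "\<And>k t. t \<in> {0..T} \<Longrightarrow> norm (x k t) \<le> R"
  obtains r z where "strict_mono (r :: nat \<Rightarrow> nat)" "ode_solution (F q) T s' \<xi>' z"
    "uniform_limit {0..T} (\<lambda>k. x (r k)) z sequentially"
proof -
  define C where "C = insert q (range p) \<times> {0..T} \<times> cball (0::'a) R"
  have "compact C"
    unfolding C_def by (intro compact_Times compact_sequence_with_limit p compact_Icc compact_cball)
  have "C \<subseteq> P \<times> {0..T} \<times> UNIV" using p by (auto simp: C_def)
  then have FC: "continuous_on C (\<lambda>(p, t, v). F p t v)" by (rule continuous_on_subset[OF F])
  have ucF: "uniformly_continuous_on C (\<lambda>(p, t, v). F p t v)"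
    using FC \<open>compact C\<close> by (rule compact_uniformly_continuous)
  have "bounded ((\<lambda>(p, t, v). F p t v) ` C)"
    using FC \<open>compact C\<close> by (intro compact_imp_bounded compact_continuous_image)
  then obtain M where M: "M > 0" "\<And>z. z \<in> C \<Longrightarrow> norm ((\<lambda>(p, t, v). F p t v) z) \<le> M"
    unfolding bounded_pos by blast
  have xC: "(p k, t, x k t) \<in> C" if "t \<in> {0..T}" for k t
    using that bd by (auto simp: C_def)
  have x': "(x k has_vector_derivative F (p k) t (x k t)) (at t within {0..T})" if "t \<in> {0..T}" for k t
    using x that by (auto simp: ode_solution_def)
  have lip1: "norm (x k t - x k u) \<le> M * \<bar>t - u\<bar>" if "u \<le> t" "t \<in> {0..T}" "u \<in> {0..T}" for k t u
  proof -
    have "norm (x k t - x k u) \<le> M * t - M * u"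
    proof (rule vector_derivative_norm_bound[OF _ _ _ that(1)])
      show "(x k has_vector_derivative F (p k) v (x k v)) (at v within {u..t})" if "v \<in> {u..t}" for v
        using x'[of v k] that \<open>t \<in> _\<close> \<open>u \<in> _\<close> by (intro has_vector_derivative_within_subset[OF x']) auto
      show "((\<lambda>v. M * v) has_real_derivative M) (at v within {u..t})" for v
        by (auto intro!: derivative_eq_intros)
      show "norm (F (p k) v (x k v)) \<le> M" if "v \<in> {u..t}" for v
        using M(2)[OF xC[of v k]] that \<open>t \<in> _\<close> \<open>u \<in> _\<close> by auto
    qed
    then show ?thesis using that by (simp add: algebra_simps)
  qed
  have lip: "norm (x k t - x k u) \<le> M * \<bar>t - u\<bar>" if "t \<in> {0..T}" "u \<in> {0..T}" for k t u
    using lip1[of u t k] lip1[of t u k] that by (cases "u \<le> t") (auto simp: norm_minus_commute abs_minus_commute)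
  obtain z r where zr: "continuous_on {0..T} z" "strict_mono (r :: nat \<Rightarrow> nat)"
    "\<And>e. 0 < e \<Longrightarrow> \<exists>N. \<forall>n t. n \<ge> N \<and> t \<in> {0..T} \<longrightarrow> norm (x (r n) t - z t) < e"
  proof (rule Arzela_Ascoli[of "{0..T}" x R])
    show "\<exists>d>0. \<forall>n y. y \<in> {0..T} \<and> norm (t - y) < d \<longrightarrow> norm (x n t - x n y) < e"
      if t: "t \<in> {0..T}" "0 < e" for t e
    proof (intro exI[of _ "e / M"] conjI allI impI)
      fix n y assume y: "y \<in> {0..T} \<and> norm (t - y) < e / M"
      then have "norm (x n t - x n y) \<le> M * \<bar>t - y\<bar>" using lip t by blast
      also have "\<dots> < e" using y M(1) by (simp add: field_simps)
      finally show "norm (x n t - x n y) < e" .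
    qed (use t M in auto)
  qed (use bd in auto)
  have ul: "uniform_limit {0..T} (\<lambda>k. x (r k)) z sequentially"
    by (rule uniform_limitI) (use zr(3) in \<open>force simp: eventually_sequentially dist_norm\<close>)
  have pr: "(\<lambda>k. p (r k)) \<longlonglongrightarrow> q"
    using LIMSEQ_subseq_LIMSEQ[OF p(3) zr(2)] by (simp add: o_def)
  have "uniform_limit {0..T} (\<lambda>k t. (p (r k), t, x (r k) t)) (\<lambda>t. (q, t, z t)) sequentially"
  proof (rule uniform_limitI)
    fix e :: real assume e: "e > 0"
    have "\<forall>\<^sub>F k in sequentially. dist (p (r k)) q < e / 2"
      using pr e by (intro tendstoD) auto
    moreover have "\<forall>\<^sub>F k in sequentially. \<forall>t\<in>{0..T}. dist (x (r k) t) (z t) < e / 2"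
      using e by (intro uniform_limitD[OF ul]) auto
    ultimately show "\<forall>\<^sub>F k in sequentially. \<forall>t\<in>{0..T}. dist (p (r k), t, x (r k) t) (q, t, z t) < e"
    proof eventually_elim
      case (elim k)
      show ?case
      proof
        fix t assume "t \<in> {0..T}"
        then have "dist (x (r k) t) (z t) < e / 2" using elim by blast
        moreover have "dist (p (r k), t, x (r k) t) (q, t, z t) \<le> dist (p (r k)) q + dist (x (r k) t) (z t)"
          by (simp add: dist_Pair_Pair sqrt_sum_squares_le_sum)
        ultimately show "dist (p (r k), t, x (r k) t) (q, t, z t) < e" using elim by linarith
      qed
    qed
  qed
  then have "uniform_limit {0..T} (\<lambda>k t. (\<lambda>(p, t, v). F p t v) (p (r k), t, x (r k) t))
      (\<lambda>t. (\<lambda>(p, t, v). F p t v) (q, t, z t)) sequentially"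
    by (rule uniform_limit_compose_uniformly_continuous_on[OF _ ucF])
       (use xC \<open>compact C\<close> in \<open>auto intro: compact_imp_closed\<close>)
  then have ulF: "uniform_limit {0..T} (\<lambda>k t. F (p (r k)) t (x (r k) t)) (\<lambda>t. F q t (z t)) sequentially"
    by simp
  have sr: "(\<lambda>k. s (r k)) \<longlonglongrightarrow> s'" "(\<lambda>k. \<xi> (r k)) \<longlonglongrightarrow> \<xi>'"
    using LIMSEQ_subseq_LIMSEQ[OF s(2) zr(2)] LIMSEQ_subseq_LIMSEQ[OF \<xi> zr(2)] by (simp_all add: o_def)
  have s': "s' \<in> {0..T}"
    using closed_sequentially[OF closed_atLeastAtMost, of s 0 T s'] s by auto
  have "ode_solution (F q) T s' \<xi>' z"
    unfolding ode_solution_def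
  proof (intro conjI ballI)
    have "(\<lambda>k. x (r k) (s (r k))) \<longlonglongrightarrow> z s'"
      by (rule tendsto_uniform_limit_moving[OF ul zr(1) s(1) s' sr(1)])
    moreover have "x (r k) (s (r k)) = \<xi> (r k)" for k
      using x by (simp add: ode_solution_def)
    ultimately show "z s' = \<xi>'" using sr(2) LIMSEQ_unique by auto
    show "(z has_vector_derivative F q t (z t)) (at t within {0..T})" if "t \<in> {0..T}" for t
      by (rule has_vector_derivative_uniform_limit[OF _ ulF _ that])
         (use x' tendsto_uniform_limitI[OF ul] in auto)
  qed
  then show ?thesis using that zr(2) ul by blast
qed

text \<open>
Kamke's theorem. If infinitely many solutions leave the tube of radius \<open>e\<close> around the limit solution
\<open>y\<close>, stop each of them at its first exit time \<open>\<tau>\<^sub>k\<close>. The stopped solutions are bounded; after rescaling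
time to \<open>{0..1}\<close> a subsequence converges to a solution of the limit problem on \<open>{0..\<sigma>}\<close>, where
\<open>\<tau>\<^sub>k \<rightarrow> \<sigma>\<close> along the subsequence. At time \<open>\<sigma>\<close> it still has distance at least \<open>e\<close> from \<open>y\<close>, which
contradicts uniqueness. Uniqueness on all \<open>{0..\<tau>}\<close>, and not only on \<open>{0..T}\<close>, is assumed because the
limit solution is known only up to \<open>\<sigma>\<close>.
\<close>

lemma ode_solutions_uniform_limit:
  fixes F :: "'p::heine_borel \<Rightarrow> real \<Rightarrow> 'a::euclidean_space \<Rightarrow> 'a"
  assumes F: "continuous_on (P \<times> {0..T} \<times> UNIV) (\<lambda>(p, t, v). F p t v)"
    and p: "\<And>k. p k \<in> P" "q \<in> P" "p \<longlonglongrightarrow> q" and \<xi>: "\<xi> \<longlonglongrightarrow> \<xi>'"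
    and x: "\<And>k. ode_solution (F (p k)) T 0 (\<xi> k) (x k)" and y: "ode_solution (F q) T 0 \<xi>' y"
    and uniq: "\<And>\<tau> z. \<tau> \<in> {0..T} \<Longrightarrow> ode_solution (F q) \<tau> 0 \<xi>' z \<Longrightarrow> z \<tau> = y \<tau>"
  shows "uniform_limit {0..T} x y sequentially"
proof (rule ccontr)
  assume "\<not> uniform_limit {0..T} x y sequentially"
  then obtain e where e: "e > 0" "\<not> (\<forall>\<^sub>F k in sequentially. \<forall>t\<in>{0..T}. dist (x k t) (y t) < e)"
    by (auto simp: uniform_limit_iff)
  then have "infinite {k. \<not> (\<forall>t\<in>{0..T}. dist (x k t) (y t) < e)}"
    by (simp only: cofinite_eq_sequentially[symmetric] eventually_cofinite not_False_eq_True)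
  then obtain r :: "nat \<Rightarrow> nat" where r: "strict_mono r" "\<forall>k. r k \<in> {k. \<not> (\<forall>t\<in>{0..T}. dist (x k t) (y t) < e)}"
    using infinite_enumerate by blast
  have xc: "continuous_on {0..T} (x k)" and yc: "continuous_on {0..T} y" for k
    by (rule ode_solution_continuous_on[OF x], rule ode_solution_continuous_on[OF y])
  have "\<exists>\<tau>\<in>{0..T}. e \<le> dist (x (r k) \<tau>) (y \<tau>) \<and> (\<forall>t\<in>{0..<\<tau>}. dist (x (r k) t) (y t) < e)" for k
  proof -
    let ?E = "{t \<in> {0..T}. e \<le> dist (x (r k) t) (y t)}"
    have "closed ?E"
      by (intro continuous_on_closed_Collect_le continuous_intros xc yc closed_atLeastAtMost)
    moreover have "bounded ?E"
      by (rule bounded_subset[OF bounded_closed_interval[of 0 T]]) auto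
    ultimately have "compact ?E"
      by (simp only: compact_eq_bounded_closed simp_thms)
    moreover have "?E \<noteq> {}" using r(2) by (force simp: not_less)
    ultimately obtain \<tau> where "\<tau> \<in> ?E" "\<forall>t\<in>?E. \<tau> \<le> t" using compact_attains_inf[of ?E] by blast
    then have \<tau>: "\<tau> \<in> {0..T}" "e \<le> dist (x (r k) \<tau>) (y \<tau>)"
      and min: "\<And>t. t \<in> {0..T} \<Longrightarrow> e \<le> dist (x (r k) t) (y t) \<Longrightarrow> \<tau> \<le> t"
      by blast+
    have "dist (x (r k) t) (y t) < e" if "t \<in> {0..<\<tau>}" for t
      using min[of t] \<tau>(1) that by (meson atLeastAtMost_iff atLeastLessThan_iff less_imp_le not_le order_trans)
    then show ?thesis using \<tau> by blast
  qed
  then obtain \<tau> where \<tau>: "\<And>k. \<tau> k \<in> {0..T}" "\<And>k. e \<le> dist (x (r k) (\<tau> k)) (y (\<tau> k))"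
    "\<And>k t. t \<in> {0..<\<tau> k} \<Longrightarrow> dist (x (r k) t) (y t) < e"
    by metis
  obtain r2 \<sigma> where r2: "strict_mono (r2 :: nat \<Rightarrow> nat)" "\<sigma> \<in> {0..T}" "(\<lambda>k. \<tau> (r2 k)) \<longlonglongrightarrow> \<sigma>"
  proof (rule seq_compactE[OF compact_imp_seq_compact[OF compact_Icc[of 0 T]], of \<tau>])
  qed (use \<tau>(1) that in \<open>simp_all add: o_def\<close>)
  obtain B where B: "\<And>t. t \<in> {0..T} \<Longrightarrow> norm (y t) \<le> B"
    using compact_continuous_norm_bound[OF compact_Icc yc] by blast
  obtain B' where B': "\<And>k. norm (\<xi> k) \<le> B'"
    using convergent_imp_bounded[OF \<xi>] unfolding bounded_iff by blast
  \<comment> \<open>The summand \<open>B'\<close> covers the case that the solution starts outside the tube, where \<open>\<tau> k = 0\<close>.\<close>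
  have bd: "norm (x (r k) t) \<le> B + e + B'" if t: "t \<in> {0..\<tau> k}" for k t
  proof (cases "\<tau> k = 0")
    case True
    then have "x (r k) t = \<xi> (r k)" using t x by (simp add: ode_solution_def)
    moreover have "0 \<le> B" using B[OF \<tau>(1)] norm_ge_zero order_trans by blast
    ultimately show ?thesis using B'[of "r k"] e by simp
  next
    case False
    then have cl: "closure {0..<\<tau> k} = {0..\<tau> k}" using \<tau>(1)[of k] by auto
    have "norm (x (r k) t - y t) \<le> e"
    proof (rule continuous_on_closure_norm_le[of "{0..<\<tau> k}"])
      show "continuous_on (closure {0..<\<tau> k}) (\<lambda>t. x (r k) t - y t)"
        unfolding cl using \<tau>(1)[of k]
        by (intro continuous_intros continuous_on_subset[OF xc] continuous_on_subset[OF yc]) auto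
      show "\<forall>t\<in>{0..<\<tau> k}. norm (x (r k) t - y t) \<le> e" using \<tau>(3) by (auto simp: dist_norm less_imp_le)
    qed (use cl t in auto)
    moreover have "norm (y t) \<le> B" using B t \<tau>(1)[of k] by auto
    moreover have "0 \<le> B'" using B' norm_ge_zero order_trans by blast
    ultimately show ?thesis using norm_triangle_sub[of "x (r k) t" "y t"] by linarith
  qed
  define G where "G = (\<lambda>(p, \<tau>) t v. \<tau> *\<^sub>R F p (\<tau> * t) v)"
  have Gc: "continuous_on ((P \<times> {0..T}) \<times> {0..1} \<times> UNIV) (\<lambda>(p, t, v). G p t v)"
  proof -
    have "continuous_on ((P \<times> {0..T}) \<times> {0..1} \<times> (UNIV :: 'a set))
       (\<lambda>z. (\<lambda>(p, t, v). F p t v) (fst (fst z), snd (fst z) * fst (snd z), snd (snd z)))"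
    proof (rule continuous_on_compose2[OF F])
      show "(\<lambda>z. (fst (fst z), snd (fst z) * fst (snd z), snd (snd z))) ` ((P \<times> {0..T}) \<times> {0..1} \<times> UNIV) \<subseteq> P \<times> {0..T} \<times> UNIV"
      proof clarsimp
        fix \<tau> t :: real assume "0 \<le> \<tau>" "\<tau> \<le> T" "0 \<le> t" "t \<le> 1"
        then show "\<tau> * t \<le> T" using mult_left_le[of t \<tau>] by linarith
      qed
    qed (intro continuous_intros)
    then have "continuous_on ((P \<times> {0..T}) \<times> {0..1} \<times> (UNIV :: 'a set))
       (\<lambda>z. snd (fst z) *\<^sub>R (\<lambda>(p, t, v). F p t v) (fst (fst z), snd (fst z) * fst (snd z), snd (snd z)))"
      by (intro continuous_intros)
    then show ?thesis by (simp add: G_def case_prod_unfold)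
  qed
  have pr: "(\<lambda>k. p (r (r2 k))) \<longlonglongrightarrow> q" "(\<lambda>k. \<xi> (r (r2 k))) \<longlonglongrightarrow> \<xi>'"
    using LIMSEQ_subseq_LIMSEQ[OF p(3) strict_mono_o[OF r(1) r2(1)]] LIMSEQ_subseq_LIMSEQ[OF \<xi> strict_mono_o[OF r(1) r2(1)]]
    by (simp_all add: o_def)
  obtain r3 z where r3: "strict_mono (r3 :: nat \<Rightarrow> nat)" "ode_solution (G (q, \<sigma>)) 1 0 \<xi>' z"
    "uniform_limit {0..1} (\<lambda>k t. x (r (r2 (r3 k))) (\<tau> (r2 (r3 k)) * t)) z sequentially"
  proof (rule ode_solutions_subsequence[OF Gc, where p = "\<lambda>k. (p (r (r2 k)), \<tau> (r2 k))" and q = "(q, \<sigma>)"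
      and s = "\<lambda>_. 0" and s' = 0 and \<xi> = "\<lambda>k. \<xi> (r (r2 k))" and \<xi>' = \<xi>' and R = "B + e + B'"
      and x = "\<lambda>k t. x (r (r2 k)) (\<tau> (r2 k) * t)"])
    show "(\<lambda>k. (p (r (r2 k)), \<tau> (r2 k))) \<longlonglongrightarrow> (q, \<sigma>)"
      using pr(1) r2(3) by (intro tendsto_Pair)
    show "ode_solution (G (p (r (r2 k)), \<tau> (r2 k))) 1 0 (\<xi> (r (r2 k))) (\<lambda>t. x (r (r2 k)) (\<tau> (r2 k) * t))" for k
      unfolding G_def using ode_solution_rescale[OF x \<tau>(1)] by simp
    show "norm (x (r (r2 k)) (\<tau> (r2 k) * t)) \<le> B + e + B'" if "t \<in> {0..1}" for k t
      by (rule bd) (use that \<tau>(1)[of "r2 k"] in \<open>auto intro: mult_left_le\<close>)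
  qed (use p \<tau> r2 pr in auto)
  have z1: "z 1 = y \<sigma>"
  proof (cases "\<sigma> = 0")
    case True
    have "norm (z 1 - z 0) \<le> 0 - 0"
    proof (rule vector_derivative_norm_bound)
      show "(z has_vector_derivative 0) (at t within {0..1})" if "t \<in> {0..1}" for t
        using r3(2) that True by (auto simp: ode_solution_def G_def)
      show "((\<lambda>_. 0) has_real_derivative 0) (at t within {0..1})" for t :: real
        by (rule DERIV_const)
    qed auto
    then show ?thesis using r3(2) y True by (simp add: ode_solution_def)
  next
    case False
    then have "ode_solution (F q) \<sigma> 0 \<xi>' (\<lambda>t. z (t / \<sigma>))"
      using r3(2) r2(2) by (intro ode_solution_unrescale) (auto simp: G_def)
    then have "z (\<sigma> / \<sigma>) = y \<sigma>" by (rule uniq[OF r2(2)])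
    then show ?thesis using False by simp
  qed
  have "(\<lambda>k. x (r (r2 (r3 k))) (\<tau> (r2 (r3 k)))) \<longlonglongrightarrow> y \<sigma>"
    using tendsto_uniform_limitI[OF r3(3), of 1] by (simp add: z1)
  moreover have \<tau>3: "(\<lambda>k. \<tau> (r2 (r3 k))) \<longlonglongrightarrow> \<sigma>"
    using LIMSEQ_subseq_LIMSEQ[OF r2(3) r3(1)] by (simp add: o_def)
  moreover have "(\<lambda>k. y (\<tau> (r2 (r3 k)))) \<longlonglongrightarrow> y \<sigma>"
    by (rule continuous_on_tendsto_compose[OF yc \<tau>3 r2(2)]) (use \<tau>(1) in auto)
  ultimately have "(\<lambda>k. dist (x (r (r2 (r3 k))) (\<tau> (r2 (r3 k)))) (y (\<tau> (r2 (r3 k))))) \<longlonglongrightarrow> dist (y \<sigma>) (y \<sigma>)"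
    by (intro tendsto_dist)
  then have "e \<le> dist (y \<sigma>) (y \<sigma>)"
    by (rule LIMSEQ_le_const) (use \<tau>(2) in auto)
  then show False using e by simp
qed

lemma ode_flow_continuous:
  fixes F :: "real \<Rightarrow> 'a::euclidean_space \<Rightarrow> 'a"
  assumes F: "continuous_on ({0..T} \<times> UNIV) (\<lambda>(t, v). F t v)"
    and x: "\<And>\<xi>. ode_solution F T 0 \<xi> (x \<xi>)"
    and uniq: "\<And>\<xi> \<tau> z. \<tau> \<in> {0..T} \<Longrightarrow> ode_solution F \<tau> 0 \<xi> z \<Longrightarrow> z \<tau> = x \<xi> \<tau>"
  shows "continuous_on (UNIV \<times> {0..T}) (\<lambda>(\<xi>, t). x \<xi> t)"
  unfolding continuous_on_sequentially
proof (intro allI ballI impI)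
  fix X :: "nat \<Rightarrow> 'a \<times> real" and a :: "'a \<times> real"
  assume a: "a \<in> UNIV \<times> {0..T}" and X: "(\<forall>n. X n \<in> UNIV \<times> {0..T}) \<and> X \<longlonglongrightarrow> a"
  have lim: "(\<lambda>n. fst (X n)) \<longlonglongrightarrow> fst a" "(\<lambda>n. snd (X n)) \<longlonglongrightarrow> snd a"
    using X by (auto intro: tendsto_fst tendsto_snd)
  \<comment> \<open>The field is fixed, so the parameter set is a singleton.\<close>
  have "continuous_on ({0 :: real} \<times> {0..T} \<times> UNIV) (\<lambda>z. (\<lambda>(t, v). F t v) (snd z))"
    by (rule continuous_on_compose2[OF F]) (auto intro!: continuous_intros)
  then have "continuous_on ({0 :: real} \<times> {0..T} \<times> UNIV) (\<lambda>(p, t, v). F t v)"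
    by (simp add: case_prod_unfold)
  then have "uniform_limit {0..T} (\<lambda>n. x (fst (X n))) (x (fst a)) sequentially"
    by (rule ode_solutions_uniform_limit[where p = "\<lambda>_. 0" and q = 0 and F = "\<lambda>_. F"
        and \<xi> = "\<lambda>n. fst (X n)" and \<xi>' = "fst a"]) (use lim(1) x uniq in auto)
  moreover have "snd (X n) \<in> {0..T}" for n
    using X by (simp add: mem_Times_iff)
  ultimately have "(\<lambda>n. x (fst (X n)) (snd (X n))) \<longlonglongrightarrow> x (fst a) (snd a)"
    using a by (intro tendsto_uniform_limit_moving[OF _ ode_solution_continuous_on[OF x] _ _ lim(2)]) auto
  then show "((\<lambda>(\<xi>, t). x \<xi> t) \<circ> X) \<longlonglongrightarrow> (\<lambda>(\<xi>, t). x \<xi> t) a"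
    by (simp add: o_def case_prod_unfold)
qed

section \<open>Linear equations\<close>

text \<open>
The function \<open>u = |z|\<^sup>2 + M\<^sup>2\<close> is differentiable, unlike \<open>|z|\<close>, and satisfies \<open>|u'| \<le> (2L + 1) u\<close>. Therefore
\<open>u\<close> is dominated by an exponential both forwards and backwards in time, as is needed for an initial
time \<open>s\<close> inside the interval.
\<close>

lemma gronwall_bound:
  fixes z :: "real \<Rightarrow> 'a::real_inner"
  assumes z: "\<And>t. t \<in> {0..T} \<Longrightarrow> (z has_vector_derivative z' t) (at t within {0..T})"
    and le: "\<And>t. t \<in> {0..T} \<Longrightarrow> norm (z' t) \<le> L * norm (z t) + M"
    and LM: "L \<ge> 0" "M \<ge> 0" and s: "s \<in> {0..T}" "z s = 0" and t: "t \<in> {0..T}"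
  shows "norm (z t) \<le> M * exp ((L + 1) * T)"
proof -
  define c where "c = 2 * L + 1"
  define u where "u t = (norm (z t))\<^sup>2 + M\<^sup>2" for t
  define u' where "u' t = 2 * (z t \<bullet> z' t)" for t
  have u: "(u has_real_derivative u' t) (at t within {0..T})" if "t \<in> {0..T}" for t
  proof -
    have "((\<lambda>t. z t \<bullet> z t + M\<^sup>2) has_real_derivative u' t) (at t within {0..T})"
      unfolding has_real_derivative_iff_has_vector_derivative u'_def has_vector_derivative_def
      by (rule derivative_eq_intros z[OF that, unfolded has_vector_derivative_def] refl)+
         (auto simp: inner_commute algebra_simps)
    then show ?thesis by (simp add: u_def[abs_def] power2_norm_eq_inner)
  qed
  have u': "\<bar>u' t\<bar> \<le> c * u t" if "t \<in> {0..T}" for t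
  proof -
    have "\<bar>u' t\<bar> \<le> 2 * (norm (z t) * norm (z' t))"
      using Cauchy_Schwarz_ineq2[of "z t" "z' t"] by (simp add: u'_def)
    also have "\<dots> \<le> 2 * (norm (z t) * (L * norm (z t) + M))"
      using le[OF that] by (intro mult_left_mono) auto
    also have "\<dots> = 2 * L * (norm (z t))\<^sup>2 + 2 * norm (z t) * M"
      by (simp add: algebra_simps power2_eq_square)
    also have "\<dots> \<le> 2 * L * (norm (z t))\<^sup>2 + ((norm (z t))\<^sup>2 + M\<^sup>2)"
      using sum_squares_bound[of "norm (z t)" M] by simp
    also have "\<dots> \<le> c * u t"
      using LM by (simp add: c_def u_def algebra_simps)
    finally show ?thesis .
  qed
  have cont: "continuous_on {0..T} u"
    using u by (rule DERIV_continuous_on)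
  have main: "u t \<le> u s * exp (c * T)"
  proof (cases "s \<le> t")
    case True
    have "u t * exp (- c * t) \<le> u s * exp (- c * s)"
    proof (rule DERIV_nonpos_imp_decreasing_open[OF True])
      fix r assume r: "s < r" "r < t"
      then have "at r within {0..T} = at r" using s t by (intro at_within_interior) auto
      then have "(u has_real_derivative u' r) (at r)" using u[of r] r s t by auto
      then have "((\<lambda>t. u t * exp (- c * t)) has_real_derivative (u' r - c * u r) * exp (- c * r)) (at r)"
        by (auto intro!: derivative_eq_intros simp: algebra_simps)
      moreover have "(u' r - c * u r) * exp (- c * r) \<le> 0"
        using u'[of r] r s t by (intro mult_nonpos_nonneg) auto
      ultimately show "\<exists>y. ((\<lambda>t. u t * exp (- c * t)) has_real_derivative y) (at r) \<and> y \<le> 0" by blast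
    next
      show "continuous_on {s..t} (\<lambda>t. u t * exp (- c * t))"
        by (intro continuous_intros continuous_on_subset[OF cont]) (use s t in auto)
    qed
    then have "u t \<le> u s * exp (c * (t - s))"
      by (simp add: exp_minus exp_diff right_diff_distrib field_simps)
    also have "\<dots> \<le> u s * exp (c * T)"
      using s t LM by (intro mult_left_mono) (auto simp: u_def c_def)
    finally show ?thesis .
  next
    case False
    then have "t \<le> s" by simp
    have "u t * exp (c * t) \<le> u s * exp (c * s)"
    proof (rule DERIV_nonneg_imp_increasing_open[OF \<open>t \<le> s\<close>])
      fix r assume r: "t < r" "r < s"
      then have "at r within {0..T} = at r" using s t by (intro at_within_interior) auto
      then have "(u has_real_derivative u' r) (at r)" using u[of r] r s t by auto
      then have "((\<lambda>t. u t * exp (c * t)) has_real_derivative (u' r + c * u r) * exp (c * r)) (at r)"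
        by (auto intro!: derivative_eq_intros simp: algebra_simps)
      moreover have "(u' r + c * u r) * exp (c * r) \<ge> 0"
        using u'[of r] r s t by (intro mult_nonneg_nonneg) auto
      ultimately show "\<exists>y. ((\<lambda>t. u t * exp (c * t)) has_real_derivative y) (at r) \<and> y \<ge> 0" by blast
    next
      show "continuous_on {t..s} (\<lambda>t. u t * exp (c * t))"
        by (intro continuous_intros continuous_on_subset[OF cont]) (use s t in auto)
    qed
    then have "u t \<le> u s * exp (c * (s - t))"
      by (simp add: exp_minus exp_diff right_diff_distrib field_simps)
    also have "\<dots> \<le> u s * exp (c * T)"
      using s t LM by (intro mult_left_mono) (auto simp: u_def c_def)
    finally show ?thesis .
  qed
  have T: "T \<ge> 0" using t by auto
  have "(norm (z t))\<^sup>2 \<le> u t" by (simp add: u_def)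
  also have "\<dots> \<le> M\<^sup>2 * exp (c * T)" using main by (simp add: u_def s)
  also have "\<dots> \<le> M\<^sup>2 * exp (2 * ((L + 1) * T))"
    using T by (intro mult_left_mono) (auto simp: c_def algebra_simps)
  also have "\<dots> = (M * exp ((L + 1) * T))\<^sup>2"
    by (simp add: power_mult_distrib exp_double)
  finally show ?thesis
    by (rule power2_le_imp_le) (use LM in auto)
qed

lemma linear_homogeneous_zero:
  fixes A :: "real \<Rightarrow> 'a::euclidean_space \<Rightarrow>\<^sub>L 'a"
  assumes A: "continuous_on {0..T} A" and s: "s \<in> {0..T}" "z s = 0"
    and z: "\<And>t. t \<in> {0..T} \<Longrightarrow> (z has_vector_derivative A t (z t)) (at t within {0..T})"
    and t: "t \<in> {0..T}"
  shows "z t = 0"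
proof -
  obtain L where L: "L > 0" "\<And>t. t \<in> {0..T} \<Longrightarrow> norm (A t) \<le> L"
    using compact_continuous_norm_bound[OF compact_Icc A] by blast
  have "norm (z t) \<le> 0 * exp ((L + 1) * T)"
  proof (rule gronwall_bound[OF z _ _ _ s t])
    show "norm (A t (z t)) \<le> L * norm (z t) + 0" if "t \<in> {0..T}" for t
      using norm_blinfun[of "A t" "z t"] mult_right_mono[OF L(2)[OF that], of "norm (z t)"] by simp
  qed (use L in auto)
  then show ?thesis by simp
qed

lemma linear_ode_unique:
  fixes A :: "real \<Rightarrow> 'a::euclidean_space \<Rightarrow>\<^sub>L 'a"
  assumes A: "continuous_on {0..T} A" and s: "s \<in> {0..T}"
    and y: "ode_solution (\<lambda>t v. A t v + b t) T s \<xi> y" "ode_solution (\<lambda>t v. A t v + b t) T s \<xi> z"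
    and t: "t \<in> {0..T}"
  shows "y t = z t"
proof -
  have "y t - z t = 0"
  proof (rule linear_homogeneous_zero[OF A s _ _ t])
    show "((\<lambda>t. y t - z t) has_vector_derivative A t (y t - z t)) (at t within {0..T})" if "t \<in> {0..T}" for t
      using has_vector_derivative_diff[of y "A t (y t) + b t" "at t within {0..T}" z "A t (z t) + b t"] y that
      by (simp add: ode_solution_def blinfun.diff_right)
  qed (use y in \<open>auto simp: ode_solution_def\<close>)
  then show ?thesis by simp
qed

text \<open>
Picard iteration. The weight \<open>exp (2 L |t - s|)\<close> makes the iteration a contraction with factor
\<open>1/2\<close> on the whole interval at once, however long it is.
\<close>

lemma linear_ode_exists:
  fixes A :: "real \<Rightarrow> 'a::euclidean_space \<Rightarrow>\<^sub>L 'a"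
  assumes A: "continuous_on {0..T} A" and b: "continuous_on {0..T} b" and s: "s \<in> {0..T}"
  obtains y where "ode_solution (\<lambda>t v. A t v + b t) T s \<xi> y"
proof -
  define \<Phi> where "\<Phi> y t = \<xi> + (integral {0..t} (\<lambda>r. A r (y r) + b r) - integral {0..s} (\<lambda>r. A r (y r) + b r))"
    for y :: "real \<Rightarrow> 'a" and t
  define y where "y n = (\<Phi> ^^ n) (\<lambda>_. \<xi>)" for n
  have y_Suc: "y (Suc n) = \<Phi> (y n)" for n by (simp add: y_def)
  have \<Phi>': "(\<Phi> u has_vector_derivative A t (u t) + b t) (at t within {0..T})"
    if "continuous_on {0..T} u" "t \<in> {0..T}" for u t
  proof -
    have "continuous_on {0..T} (\<lambda>r. A r (u r) + b r)"
      by (intro continuous_intros A b that)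
    from integral_has_vector_derivative[OF this that(2)]
    have "((\<lambda>t. \<xi> + (integral {0..t} (\<lambda>r. A r (u r) + b r) - integral {0..s} (\<lambda>r. A r (u r) + b r)))
      has_vector_derivative 0 + (A t (u t) + b t - 0)) (at t within {0..T})"
      by (intro has_vector_derivative_add has_vector_derivative_diff has_vector_derivative_const)
    then show ?thesis by (simp add: \<Phi>_def[abs_def])
  qed
  have yc: "continuous_on {0..T} (y n)" for n
  proof (induction n)
    case (Suc n)
    show ?case
      unfolding y_Suc continuous_on_eq_continuous_within
      using has_vector_derivative_continuous[OF \<Phi>'[OF Suc]] by blast
  qed (simp add: y_def)
  have y': "(y (Suc n) has_vector_derivative A t (y n t) + b t) (at t within {0..T})" if "t \<in> {0..T}" for n t
    unfolding y_Suc by (rule \<Phi>'[OF yc that])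
  have ys: "y n s = \<xi>" for n
    by (cases n) (simp_all add: y_Suc \<Phi>_def, simp add: y_def)
  obtain L where L: "L > 0" "\<And>t. t \<in> {0..T} \<Longrightarrow> norm (A t) \<le> L"
    using compact_continuous_norm_bound[OF compact_Icc A] by blast
  have "continuous_on {0..T} (\<lambda>t. y 1 t - y 0 t)" by (intro continuous_intros yc)
  then obtain K where K: "K > 0" "\<And>t. t \<in> {0..T} \<Longrightarrow> norm (y 1 t - y 0 t) \<le> K"
    using compact_continuous_norm_bound[OF compact_Icc] by blast
  have step: "norm (y (Suc n) t - y n t) \<le> K * (1 / 2) ^ n * exp (2 * L * \<bar>t - s\<bar>)" if "t \<in> {0..T}" for n t
    using that
  proof (induction n arbitrary: t)
    case 0
    have "K * 1 \<le> K * exp (2 * L * \<bar>t - s\<bar>)" using K(1) L(1) by (intro mult_left_mono) auto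
    then show ?case using K(2)[OF 0] by simp
  next
    case (Suc n)
    define c where "c = K * (1 / 2) ^ n"
    define z where "z t = y (Suc (Suc n)) t - y (Suc n) t" for t
    have z': "(z has_vector_derivative A r (y (Suc n) r - y n r)) (at r within {0..T})" if "r \<in> {0..T}" for r
      using has_vector_derivative_diff[OF y'[OF that, of "Suc n"] y'[OF that, of n]]
      by (simp add: z_def[abs_def] blinfun.diff_right)
    have z'_le: "norm (A r (y (Suc n) r - y n r)) \<le> L * (c * exp (2 * L * \<bar>r - s\<bar>))" if "r \<in> {0..T}" for r
      using norm_blinfun[of "A r" "y (Suc n) r - y n r"]
        mult_mono[OF L(2)[OF that] Suc.IH[OF that]] L(1) by (simp add: c_def)
    have zs: "z s = 0" by (simp add: z_def ys)
    have c: "c > 0" using K by (simp add: c_def)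
    have "norm (z t) \<le> c / 2 * exp (2 * L * \<bar>t - s\<bar>)"
    proof (cases "s \<le> t")
      case True
      have "norm (z t - z s) \<le> c / 2 * exp (2 * L * (t - s)) - c / 2 * exp (2 * L * (s - s))"
      proof (rule vector_derivative_norm_bound[OF _ _ _ True])
        fix r assume r: "r \<in> {s..t}"
        then have r0: "r \<in> {0..T}" using s Suc.prems by auto
        show "(z has_vector_derivative A r (y (Suc n) r - y n r)) (at r within {s..t})"
          by (rule has_vector_derivative_within_subset[OF z'[OF r0]]) (use s Suc.prems in auto)
        show "((\<lambda>r. c / 2 * exp (2 * L * (r - s))) has_real_derivative L * (c * exp (2 * L * (r - s)))) (at r within {s..t})"
          by (auto intro!: derivative_eq_intros)
        show "norm (A r (y (Suc n) r - y n r)) \<le> L * (c * exp (2 * L * (r - s)))"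
          using z'_le[OF r0] r by simp
      qed
      then show ?thesis using zs True c by simp
    next
      case False
      then have ts: "t \<le> s" by simp
      have "norm (z s - z t) \<le> - (c / 2 * exp (2 * L * (s - s))) - - (c / 2 * exp (2 * L * (s - t)))"
      proof (rule vector_derivative_norm_bound[OF _ _ _ ts])
        fix r assume r: "r \<in> {t..s}"
        then have r0: "r \<in> {0..T}" using s Suc.prems by auto
        show "(z has_vector_derivative A r (y (Suc n) r - y n r)) (at r within {t..s})"
          by (rule has_vector_derivative_within_subset[OF z'[OF r0]]) (use s Suc.prems in auto)
        show "((\<lambda>r. - (c / 2 * exp (2 * L * (s - r)))) has_real_derivative L * (c * exp (2 * L * (s - r)))) (at r within {t..s})"
          by (auto intro!: derivative_eq_intros)
        show "norm (A r (y (Suc n) r - y n r)) \<le> L * (c * exp (2 * L * (s - r)))"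
          using z'_le[OF r0] r by simp
      qed
      then show ?thesis using zs False c by simp
    qed
    then show ?case by (simp add: z_def c_def)
  qed
  define E where "E = exp (2 * L * T)"
  have "norm (y (Suc n) t - y n t) \<le> K * (1 / 2) ^ n * E" if "t \<in> {0..T}" for n t
  proof -
    have "\<bar>t - s\<bar> \<le> T" using that s by auto
    then have "exp (2 * L * \<bar>t - s\<bar>) \<le> E" using L by (simp add: E_def)
    then have "K * (1 / 2) ^ n * exp (2 * L * \<bar>t - s\<bar>) \<le> K * (1 / 2) ^ n * E"
      using K by (intro mult_left_mono) auto
    then show ?thesis using step[OF that, of n] by linarith
  qed
  moreover have "summable (\<lambda>n. K * (1 / 2) ^ n * E)"
    by (intro summable_mult summable_mult2 summable_geometric) auto
  ultimately have "uniform_limit {0..T} (\<lambda>n t. \<Sum>i<n. y (Suc i) t - y i t) (\<lambda>t. suminf (\<lambda>i. y (Suc i) t - y i t)) sequentially"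
    by (rule Weierstrass_m_test)
  moreover have "(\<Sum>i<n. y (Suc i) t - y i t) = y n t - y 0 t" for n t
    by (rule sum_lessThan_telescope)
  ultimately have "uniform_limit {0..T} (\<lambda>n t. y n t - y 0 t) (\<lambda>t. suminf (\<lambda>i. y (Suc i) t - y i t)) sequentially"
    by simp
  then have "uniform_limit {0..T} (\<lambda>n t. (y n t - y 0 t) + y 0 t) (\<lambda>t. suminf (\<lambda>i. y (Suc i) t - y i t) + y 0 t) sequentially"
    by (intro uniform_limit_add) (auto intro: uniform_limitI)
  then obtain w where w: "uniform_limit {0..T} y w sequentially"
    by (simp only: diff_add_cancel eta_contract_eq)
  have w': "uniform_limit {0..T} (\<lambda>n t. A t (y n t) + b t) (\<lambda>t. A t (w t) + b t) sequentially"
  proof (rule uniform_limitI)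
    fix e :: real assume "e > 0"
    then have "e / L > 0" using L by simp
    from uniform_limitD[OF w this]
    show "\<forall>\<^sub>F n in sequentially. \<forall>t\<in>{0..T}. dist (A t (y n t) + b t) (A t (w t) + b t) < e"
    proof eventually_elim
      case (elim n)
      have "dist (A t (y n t) + b t) (A t (w t) + b t) < e" if "t \<in> {0..T}" for t
      proof -
        have "dist (A t (y n t) + b t) (A t (w t) + b t) = norm (A t (y n t - w t))"
          by (simp add: dist_norm blinfun.diff_right)
        also have "\<dots> \<le> norm (A t) * norm (y n t - w t)" by (rule norm_blinfun)
        also have "\<dots> \<le> L * norm (y n t - w t)" using L that by (intro mult_right_mono) auto
        also have "\<dots> < e" using elim that L by (auto simp: dist_norm field_simps)
        finally show ?thesis .
      qed
      then show ?case by blast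
    qed
  qed
  have yw: "(\<lambda>n. y (Suc n) t) \<longlonglongrightarrow> w t" if "t \<in> {0..T}" for t
    using tendsto_uniform_limitI[OF w that] by (rule LIMSEQ_Suc)
  have "ode_solution (\<lambda>t v. A t v + b t) T s \<xi> w"
    unfolding ode_solution_def
  proof (intro conjI ballI)
    show "w s = \<xi>" using yw[OF s] by (simp add: ys LIMSEQ_const_iff)
    show "(w has_vector_derivative A t (w t) + b t) (at t within {0..T})" if "t \<in> {0..T}" for t
      by (rule has_vector_derivative_uniform_limit[OF y' w' yw that])
  qed
  then show ?thesis by (rule that)
qed

text \<open>
For linear equations the bound of Gronwall excludes escape, so compactness and uniqueness suffice and
the initial time may vary with \<open>k\<close>.
\<close>

lemma linear_ode_solutions_tendsto:
  fixes A :: "'p::heine_borel \<Rightarrow> real \<Rightarrow> 'a::euclidean_space \<Rightarrow>\<^sub>L 'a"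
  assumes A: "continuous_on (P \<times> {0..T}) (\<lambda>(p, t). A p t)" and b: "continuous_on (P \<times> {0..T}) (\<lambda>(p, t). b p t)"
    and p: "\<And>k. p k \<in> P" "q \<in> P" "p \<longlonglongrightarrow> q"
    and s: "\<And>k. s k \<in> {0..T}" "s' \<in> {0..T}" "s \<longlonglongrightarrow> s'"
    and y: "\<And>k. ode_solution (\<lambda>t v. A (p k) t v + b (p k) t) T (s k) 0 (y k)"
    and z: "ode_solution (\<lambda>t v. A q t v + b q t) T s' 0 z"
    and t: "t \<in> {0..T}"
  shows "(\<lambda>k. y k t) \<longlonglongrightarrow> z t"
proof -
  define C where "C = insert q (range p) \<times> {0..T}"
  have "compact C"
    unfolding C_def by (intro compact_Times compact_sequence_with_limit p compact_Icc)
  have CP: "C \<subseteq> P \<times> {0..T}" using p by (auto simp: C_def)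
  obtain L where L: "L > 0" "\<And>x. x \<in> C \<Longrightarrow> norm ((\<lambda>(p, t). A p t) x) \<le> L"
    using compact_continuous_norm_bound[OF \<open>compact C\<close> continuous_on_subset[OF A CP]] by blast
  obtain M where M: "M > 0" "\<And>x. x \<in> C \<Longrightarrow> norm ((\<lambda>(p, t). b p t) x) \<le> M"
    using compact_continuous_norm_bound[OF \<open>compact C\<close> continuous_on_subset[OF b CP]] by blast
  have bd: "norm (y k t) \<le> M * exp ((L + 1) * T)" if "t \<in> {0..T}" for k t
  proof (rule gronwall_bound[OF _ _ _ _ s(1)[of k] _ that])
    fix t assume t: "t \<in> {0..T}"
    show "(y k has_vector_derivative A (p k) t (y k t) + b (p k) t) (at t within {0..T})"
      using y t by (auto simp: ode_solution_def)
    have C: "(p k, t) \<in> C" using t by (auto simp: C_def)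
    have "norm (A (p k) t (y k t)) \<le> norm (A (p k) t) * norm (y k t)" by (rule norm_blinfun)
    also have "\<dots> \<le> L * norm (y k t)" using L(2)[OF C] by (intro mult_right_mono) auto
    finally show "norm (A (p k) t (y k t) + b (p k) t) \<le> L * norm (y k t) + M"
      using M(2)[OF C] by (intro norm_triangle_le) auto
  qed (use L M y in \<open>auto simp: ode_solution_def\<close>)
  have Aq: "continuous_on {0..T} (A q)"
  proof -
    have "continuous_on {0..T} (Pair q :: real \<Rightarrow> _)" "Pair q ` {0..T} \<subseteq> P \<times> {0..T}"
      using p(2) by (auto intro!: continuous_intros)
    from continuous_on_compose2[OF A this] show ?thesis by simp
  qed
  have F: "continuous_on (P \<times> {0..T} \<times> UNIV) (\<lambda>(p, t, v). A p t v + b p t)"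
  proof -
    have m: "(\<lambda>z. (fst z, fst (snd z))) ` (P \<times> {0..T} \<times> (UNIV :: 'a set)) \<subseteq> P \<times> {0..T}" by auto
    have "continuous_on (P \<times> {0..T} \<times> (UNIV :: 'a set)) (\<lambda>z. (\<lambda>(p, t). A p t) (fst z, fst (snd z)))"
      by (rule continuous_on_compose2[OF A _ m]) (intro continuous_intros)
    moreover have "continuous_on (P \<times> {0..T} \<times> (UNIV :: 'a set)) (\<lambda>z. (\<lambda>(p, t). b p t) (fst z, fst (snd z)))"
      by (rule continuous_on_compose2[OF b _ m]) (intro continuous_intros)
    ultimately have "continuous_on (P \<times> {0..T} \<times> (UNIV :: 'a set))
      (\<lambda>z. (\<lambda>(p, t). A p t) (fst z, fst (snd z)) (snd (snd z)) + (\<lambda>(p, t). b p t) (fst z, fst (snd z)))"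
      by (intro continuous_intros)
    then show ?thesis by (simp add: case_prod_unfold)
  qed
  show ?thesis
  proof (rule tendsto_sub_subsequenceI)
    fix r :: "nat \<Rightarrow> nat" assume r: "strict_mono r"
    obtain r' w where r': "strict_mono (r' :: nat \<Rightarrow> nat)" "ode_solution (\<lambda>t v. A q t v + b q t) T s' 0 w"
      "uniform_limit {0..T} (\<lambda>k. y (r (r' k))) w sequentially"
    proof (rule ode_solutions_subsequence[OF F, where p = "\<lambda>k. p (r k)" and q = q and s = "\<lambda>k. s (r k)"
          and s' = s' and \<xi> = "\<lambda>_. 0" and \<xi>' = 0 and x = "\<lambda>k. y (r k)" and R = "M * exp ((L + 1) * T)"])
      show "(\<lambda>k. p (r k)) \<longlonglongrightarrow> q" "(\<lambda>k. s (r k)) \<longlonglongrightarrow> s'"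
        using LIMSEQ_subseq_LIMSEQ[OF p(3) r] LIMSEQ_subseq_LIMSEQ[OF s(3) r] by (simp_all add: o_def)
    qed (use p s y bd in auto)
    have "w t = z t" by (rule linear_ode_unique[OF Aq s(2) r'(2) z t])
    then show "\<exists>r'. strict_mono r' \<and> (\<lambda>k. y (r (r' k)) t) \<longlonglongrightarrow> z t"
      using r'(1) tendsto_uniform_limitI[OF r'(3) t] by auto
  qed
qed

section \<open>Difference quotients of the unperturbed field\<close>

text \<open>
\<open>H(t, x, h)\<close> is the mean of the derivative of \<open>f(t, \<cdot>)\<close> over the segment from \<open>x\<close> to \<open>x + h\<close>. It extends
the difference quotient of \<open>f\<close> continuously to \<open>h = 0\<close>.
\<close>

lemma hadamard_quotient:
  fixes f :: "real \<Rightarrow> 'a::euclidean_space \<Rightarrow> 'a"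
  assumes "continuously_differentiable (\<lambda>(t, x). f t x)"
  obtains H :: "real \<Rightarrow> 'a \<Rightarrow> 'a \<Rightarrow> 'a \<Rightarrow>\<^sub>L 'a" where
    "continuous_on UNIV (\<lambda>(t, x, h). H t x h)"
    "\<And>t x h. f t (x + h) = f t x + H t x h h"
    "\<And>t x. (f t has_derivative H t x 0) (at x)"
proof -
  obtain F' :: "real \<times> 'a \<Rightarrow> (real \<times> 'a) \<Rightarrow>\<^sub>L 'a" where F':
    "\<And>p. ((\<lambda>(t, x). f t x) has_derivative blinfun_apply (F' p)) (at p)" "continuous_on UNIV F'"
    using assms by (auto simp: continuously_differentiable_def)
  define E :: "'a \<Rightarrow>\<^sub>L (real \<times> 'a)" where "E = Blinfun (\<lambda>h. (0, h))"
  have E: "blinfun_apply E = (\<lambda>h. (0, h))"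
    unfolding E_def by (intro bounded_linear_Blinfun_apply bounded_linear_intros)
  define D where "D t x = F' (t, x) o\<^sub>L E" for t x
  have D: "(f t has_derivative D t x) (at x)" for t x
  proof -
    have "((\<lambda>x. (t, x)) has_derivative (\<lambda>h. (0, h))) (at x)"
      by (auto intro!: derivative_eq_intros)
    from has_derivative_compose[OF this F'(1)] show ?thesis
      by (simp add: D_def E blinfun_compose.rep_eq o_def)
  qed
  have Dc: "continuous_on S (\<lambda>z. D (u z) (v z))" if "continuous_on S u" "continuous_on S v"
    for S :: "'c::topological_space set" and u v
    unfolding D_def
    by (intro bounded_bilinear.continuous_on[OF bounded_bilinear_blinfun_compose]
        continuous_on_compose2[OF F'(2)] continuous_intros that) auto
  define H where "H t x h = integral (cbox 0 (1::real)) (\<lambda>\<sigma>. D t (x + \<sigma> *\<^sub>R h))" for t x h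
  show ?thesis
  proof
    have "continuous_on UNIV (\<lambda>z :: real \<times> 'a \<times> 'a. integral (cbox 0 (1::real))
        (\<lambda>\<sigma>. D (fst z) (fst (snd z) + \<sigma> *\<^sub>R snd (snd z))))"
      by (rule integral_continuous_on_param)
         (unfold case_prod_unfold, intro Dc continuous_intros)
    then show "continuous_on UNIV (\<lambda>(t, x, h). H t x h)"
      by (simp add: H_def case_prod_unfold)
    show "f t (x + h) = f t x + H t x h h" for t x h
    proof -
      have "f t (x + h) - f t x = integral {0..1} (\<lambda>\<sigma>. D t (x + \<sigma> *\<^sub>R h) h)"
        by (rule mvt_integral[of UNIV]) (use D in auto)
      also have "\<dots> = H t x h h"
        unfolding H_def cbox_interval[symmetric]
        by (rule blinfun_apply_integral[symmetric]) (intro integrable_continuous Dc continuous_intros)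
      finally show ?thesis by (simp add: algebra_simps)
    qed
    show "(f t has_derivative H t x 0) (at x)" for t x
      using D by (simp add: H_def)
  qed
qed

text \<open>
The difference of two solutions solves the linear homogeneous equation with the coefficient
\<open>H(t, x, y - x)\<close>, so no local Lipschitz constant of \<open>f\<close> has to be found.
\<close>

lemma smooth_ode_unique:
  fixes f :: "real \<Rightarrow> 'a::euclidean_space \<Rightarrow> 'a"
  assumes H: "continuous_on UNIV (\<lambda>(t, x, h). H t x h :: 'a \<Rightarrow>\<^sub>L 'a)" "\<And>t x h. f t (x + h) = f t x + H t x h h"
    and x: "ode_solution f T s \<xi> x" and y: "ode_solution f T s \<xi> y" and s: "s \<in> {0..T}" and t: "t \<in> {0..T}"
  shows "y t = x t"
proof -
  have "y t - x t = 0"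
  proof (rule linear_homogeneous_zero[where A = "\<lambda>t. H t (x t) (y t - x t)", OF _ s _ _ t])
    have "continuous_on {0..T} (\<lambda>t. (\<lambda>(t, x, h). H t x h) (t, x t, y t - x t))"
      using ode_solution_continuous_on[OF x] ode_solution_continuous_on[OF y]
      by (intro continuous_on_compose2[OF H(1)] continuous_intros) auto
    then show "continuous_on {0..T} (\<lambda>t. H t (x t) (y t - x t))" by simp
    show "((\<lambda>t. y t - x t) has_vector_derivative H t (x t) (y t - x t) (y t - x t)) (at t within {0..T})"
      if "t \<in> {0..T}" for t
    proof -
      have "((\<lambda>t. y t - x t) has_vector_derivative f t (y t) - f t (x t)) (at t within {0..T})"
        using x y that by (intro has_vector_derivative_diff) (auto simp: ode_solution_def)
      then show ?thesis using H(2)[of t "x t" "y t - x t"] by simp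
    qed
  qed (use x y in \<open>auto simp: ode_solution_def\<close>)
  then show ?thesis by simp
qed

section \<open>First-order expansion of the perturbed flow\<close>

locale smooth_perturbation =
  fixes f :: "real \<Rightarrow> 'a::euclidean_space \<Rightarrow> 'a" and g :: "real \<Rightarrow> 'a \<Rightarrow> real \<Rightarrow> 'a"
    and T :: real and H :: "real \<Rightarrow> 'a \<Rightarrow> 'a \<Rightarrow> 'a \<Rightarrow>\<^sub>L 'a"
  assumes T_pos: "T > 0"
    and f_cont: "continuous_on UNIV (\<lambda>(t, x). f t x)"
    and g_cont: "continuous_on (UNIV \<times> UNIV \<times> {0..1}) (\<lambda>(t, x, \<epsilon>). g t x \<epsilon>)"
    and H_cont: "continuous_on UNIV (\<lambda>(t, x, h). H t x h)"
    and H_quotient: "\<And>t x h. f t (x + h) = f t x + H t x h h"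
    and H_derivative: "\<And>t x. (f t has_derivative H t x 0) (at x)"
    and unperturbed_global: "\<And>\<xi>. \<exists>x. ode_solution f T 0 \<xi> x"
    and perturbed_unique_global: "\<And>t0 \<xi> \<epsilon>. t0 \<in> {0..T} \<Longrightarrow> \<epsilon> \<in> {0<..1} \<Longrightarrow>
      \<exists>x. ode_solution (perturbed_field f g \<epsilon>) T t0 \<xi> x \<and>
        (\<forall>y. ode_solution (perturbed_field f g \<epsilon>) T t0 \<xi> y \<longrightarrow> (\<forall>t\<in>{0..T}. y t = x t))"
begin

definition \<Omega> :: "'a \<Rightarrow> real \<Rightarrow> 'a" where "\<Omega> \<xi> t = ode_value f T 0 \<xi> t"

definition perturbed_flow :: "real \<Rightarrow> 'a \<Rightarrow> real \<Rightarrow> 'a" where "perturbed_flow \<epsilon> \<xi> t = ode_value (perturbed_field f g \<epsilon>) T 0 \<xi> t"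

text \<open>
The equation of the scaled deviation \<open>(x\<^sub>\<epsilon> - \<Omega>) / \<epsilon>\<close>. The division by \<open>\<epsilon>\<close> has been carried out, so that
the formula also makes sense at \<open>\<epsilon> = 0\<close>.
\<close>

definition deviation_field :: "real \<times> 'a \<Rightarrow> real \<Rightarrow> 'a \<Rightarrow> 'a"
  where "deviation_field = (\<lambda>(\<epsilon>, \<xi>) t v. H t (\<Omega> \<xi> t) (\<epsilon> *\<^sub>R v) v + g t (\<Omega> \<xi> t + \<epsilon> *\<^sub>R v) \<epsilon>)"

lemma compose_H:
  assumes "continuous_on S t" "continuous_on S x" "continuous_on S h"
  shows "continuous_on S (\<lambda>z. H (t z) (x z) (h z))"
proof -
  have "continuous_on S (\<lambda>z. (\<lambda>(t, x, h). H t x h) (t z, x z, h z))"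
    by (rule continuous_on_compose2[OF H_cont]) (use assms in \<open>auto intro!: continuous_intros\<close>)
  then show ?thesis by simp
qed

lemma compose_g:
  assumes "continuous_on S t" "continuous_on S x" "continuous_on S \<epsilon>" "\<And>z. z \<in> S \<Longrightarrow> \<epsilon> z \<in> {0..1}"
  shows "continuous_on S (\<lambda>z. g (t z) (x z) (\<epsilon> z))"
proof -
  have "continuous_on S (\<lambda>z. (\<lambda>(t, x, \<epsilon>). g t x \<epsilon>) (t z, x z, \<epsilon> z))"
    by (rule continuous_on_compose2[OF g_cont]) (use assms in \<open>auto intro!: continuous_intros\<close>)
  then show ?thesis by simp
qed

lemma \<Omega>_solution: "ode_solution f T 0 \<xi> (\<Omega> \<xi>)"
proof -
  obtain x where x: "ode_solution f T 0 \<xi> x" using unperturbed_global by blast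
  have "\<Omega> \<xi> t = x t" if "t \<in> {0..T}" for t
    unfolding \<Omega>_def using T_pos
    by (intro ode_value_eq x) (rule smooth_ode_unique[OF H_cont H_quotient x _ _ that], auto)
  then show ?thesis by (intro ode_solution_cong[OF x]) (use T_pos in auto)
qed

lemma \<Omega>_unique:
  assumes "ode_solution f \<tau> 0 \<xi> z" "\<tau> \<in> {0..T}"
  shows "z \<tau> = \<Omega> \<xi> \<tau>"
  by (rule smooth_ode_unique[OF H_cont H_quotient ode_solution_restrict[OF \<Omega>_solution assms(2)] assms(1)])
     (use assms in auto)

lemma \<Omega>_continuous: "continuous_on (UNIV \<times> {0..T}) (\<lambda>(\<xi>, t). \<Omega> \<xi> t)"
  using continuous_on_subset[OF f_cont subset_UNIV] \<Omega>_solution \<Omega>_unique by (rule ode_flow_continuous)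

lemma compose_\<Omega>:
  assumes "continuous_on S \<xi>" "continuous_on S t" "\<And>z. z \<in> S \<Longrightarrow> t z \<in> {0..T}"
  shows "continuous_on S (\<lambda>z. \<Omega> (\<xi> z) (t z))"
proof -
  have "continuous_on S (\<lambda>z. (\<lambda>(\<xi>, t). \<Omega> \<xi> t) (\<xi> z, t z))"
    by (rule continuous_on_compose2[OF \<Omega>_continuous]) (use assms in \<open>auto intro!: continuous_intros\<close>)
  then show ?thesis by simp
qed

lemma perturbed_flow_unique:
  assumes \<epsilon>: "\<epsilon> \<in> {0<..1}" and z: "ode_solution (perturbed_field f g \<epsilon>) T 0 \<xi> z" and t: "t \<in> {0..T}"
  shows "z t = perturbed_flow \<epsilon> \<xi> t"
proof -
  have "0 \<in> {0..T}" using T_pos by simp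
  from perturbed_unique_global[OF this \<epsilon>] obtain x where
    "ode_solution (perturbed_field f g \<epsilon>) T 0 \<xi> x"
    "\<And>y t. ode_solution (perturbed_field f g \<epsilon>) T 0 \<xi> y \<Longrightarrow> t \<in> {0..T} \<Longrightarrow> y t = x t" by metis
  then show ?thesis unfolding perturbed_flow_def using ode_value_eq z t by metis
qed

lemma perturbed_flow_solution:
  assumes \<epsilon>: "\<epsilon> \<in> {0<..1}"
  shows "ode_solution (perturbed_field f g \<epsilon>) T 0 \<xi> (perturbed_flow \<epsilon> \<xi>)"
proof -
  have 0: "0 \<in> {0..T}" using T_pos by simp
  then obtain x where x: "ode_solution (perturbed_field f g \<epsilon>) T 0 \<xi> x"
    using perturbed_unique_global[OF 0 \<epsilon>] by blast
  show ?thesis by (rule ode_solution_cong[OF x 0 perturbed_flow_unique[OF \<epsilon> x, symmetric]]) auto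
qed

lemma perturbed_flow_continuous:
  assumes \<epsilon>: "\<epsilon> \<in> {0<..1}"
  shows "continuous_on (UNIV \<times> {0..T}) (\<lambda>(\<xi>, t). perturbed_flow \<epsilon> \<xi> t)"
proof (rule ode_flow_continuous[OF _ perturbed_flow_solution[OF \<epsilon>]])
  have "continuous_on ({0..T} \<times> UNIV) (\<lambda>z. (\<lambda>(t, x). f t x) z + \<epsilon> *\<^sub>R g (fst z) (snd z) \<epsilon>)"
    by (intro continuous_intros compose_g continuous_on_subset[OF f_cont]) (use \<epsilon> in auto)
  then show "continuous_on ({0..T} \<times> UNIV) (\<lambda>(t, x). perturbed_field f g \<epsilon> t x)"
    by (simp add: perturbed_field_def case_prod_unfold)
  show "z \<tau> = perturbed_flow \<epsilon> \<xi> \<tau>" if "\<tau> \<in> {0..T}" "ode_solution (perturbed_field f g \<epsilon>) \<tau> 0 \<xi> z" for \<xi> \<tau> z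
  proof (rule ode_unique_before[where T = T and y = "perturbed_flow \<epsilon> \<xi>", OF _ _ that])
    show "\<exists>x. ode_solution (perturbed_field f g \<epsilon>) T t0 \<zeta> x" if "t0 \<in> {0..T}" for t0 \<zeta>
      using perturbed_unique_global[OF that \<epsilon>] by blast
    show "u \<tau> = perturbed_flow \<epsilon> \<xi> \<tau>" if "ode_solution (perturbed_field f g \<epsilon>) T 0 \<xi> u" for u
      by (rule perturbed_flow_unique[OF \<epsilon> that \<open>\<tau> \<in> _\<close>])
  qed
qed

lemma deviation_field_continuous:
  "continuous_on (({0..1} \<times> UNIV) \<times> {0..T} \<times> UNIV) (\<lambda>(p, t, v). deviation_field p t v)"
  unfolding deviation_field_def case_prod_unfold
  by (intro continuous_intros compose_H compose_g compose_\<Omega>) auto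

lemma deviation_solution:
  assumes \<epsilon>: "\<epsilon> \<in> {0<..1}"
  shows "ode_solution (deviation_field (\<epsilon>, \<xi>)) T 0 0 (\<lambda>t. (perturbed_flow \<epsilon> \<xi> t - \<Omega> \<xi> t) /\<^sub>R \<epsilon>)"
  unfolding ode_solution_def
proof (intro conjI ballI)
  have x: "ode_solution (perturbed_field f g \<epsilon>) T 0 \<xi> (perturbed_flow \<epsilon> \<xi>)" by (rule perturbed_flow_solution[OF \<epsilon>])
  show "(perturbed_flow \<epsilon> \<xi> 0 - \<Omega> \<xi> 0) /\<^sub>R \<epsilon> = 0"
    using x \<Omega>_solution by (simp add: ode_solution_def)
  fix t assume t: "t \<in> {0..T}"
  define w where "w = (perturbed_flow \<epsilon> \<xi> t - \<Omega> \<xi> t) /\<^sub>R \<epsilon>"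
  have xw: "perturbed_flow \<epsilon> \<xi> t = \<Omega> \<xi> t + \<epsilon> *\<^sub>R w" using \<epsilon> by (simp add: w_def)
  have "((\<lambda>t. (1 / \<epsilon>) *\<^sub>R (perturbed_flow \<epsilon> \<xi> t - \<Omega> \<xi> t)) has_vector_derivative
      (1 / \<epsilon>) *\<^sub>R (perturbed_field f g \<epsilon> t (perturbed_flow \<epsilon> \<xi> t) - f t (\<Omega> \<xi> t))) (at t within {0..T})"
    using x \<Omega>_solution t
    by (intro bounded_linear.has_vector_derivative[OF bounded_linear_scaleR_right] has_vector_derivative_diff)
       (auto simp: ode_solution_def)
  moreover have "(1 / \<epsilon>) *\<^sub>R (perturbed_field f g \<epsilon> t (perturbed_flow \<epsilon> \<xi> t) - f t (\<Omega> \<xi> t)) = deviation_field (\<epsilon>, \<xi>) t w"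
    using \<epsilon> by (simp add: perturbed_field_def xw H_quotient blinfun.scaleR_right deviation_field_def scaleR_right_distrib)
  ultimately show "((\<lambda>t. (perturbed_flow \<epsilon> \<xi> t - \<Omega> \<xi> t) /\<^sub>R \<epsilon>) has_vector_derivative
      deviation_field (\<epsilon>, \<xi>) t ((perturbed_flow \<epsilon> \<xi> t - \<Omega> \<xi> t) /\<^sub>R \<epsilon>)) (at t within {0..T})"
    by (simp add: w_def divide_inverse_commute)
qed

lemma linearized_field_eq:
  "linearized_field f g T \<xi> = (\<lambda>t v. H t (\<Omega> \<xi> t) 0 v + g t (\<Omega> \<xi> t) 0)"
  using frechet_derivative_at[OF H_derivative] by (simp add: linearized_field_def \<Omega>_def fun_eq_iff)

lemma linearized_continuous:
  "continuous_on (UNIV \<times> {0..T}) (\<lambda>(\<xi>, t). H t (\<Omega> \<xi> t) 0)"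
  "continuous_on (UNIV \<times> {0..T}) (\<lambda>(\<xi>, t). g t (\<Omega> \<xi> t) 0)"
  "continuous_on {0..T} (\<lambda>t. H t (\<Omega> \<xi> t) 0)"
  "continuous_on {0..T} (\<lambda>t. g t (\<Omega> \<xi> t) 0)"
  unfolding case_prod_unfold
  by (intro continuous_intros compose_H compose_g compose_\<Omega>; auto)+

lemma averaging_operator_eq:
  assumes s: "s \<in> {0..T}" and y: "ode_solution (linearized_field f g T \<xi>) T s 0 y"
  shows "averaging_operator f g T s \<xi> = y T - y 0"
proof -
  have "ode_value (linearized_field f g T \<xi>) T s 0 t = y t" if "t \<in> {0..T}" for t
    by (rule ode_value_eq[OF y])
       (use linear_ode_unique[OF linearized_continuous(3) s _ _ that] y in \<open>simp add: linearized_field_eq\<close>)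
  then show ?thesis using T_pos by (simp add: averaging_operator_def)
qed

lemma linearized_solution:
  assumes "s \<in> {0..T}"
  obtains y where "ode_solution (linearized_field f g T \<xi>) T s 0 y"
  unfolding linearized_field_eq using linear_ode_exists[OF linearized_continuous(3,4) assms] .

text \<open>
The joint continuity in the initial time \<open>s\<close> and in \<open>\<xi>\<close> is what makes \<open>s \<mapsto> -\<Phi>\<^sup>s\<close> an admissible homotopy.
\<close>

lemma averaging_operator_continuous:
  "continuous_on ({0..T} \<times> UNIV) (\<lambda>(s, \<xi>). averaging_operator f g T s \<xi>)"
  unfolding continuous_on_sequentially
proof (intro allI ballI impI)
  fix Y :: "nat \<Rightarrow> real \<times> 'a" and a :: "real \<times> 'a"
  assume a: "a \<in> {0..T} \<times> UNIV" and Y: "(\<forall>n. Y n \<in> {0..T} \<times> UNIV) \<and> Y \<longlonglongrightarrow> a"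
  have fa: "fst a \<in> {0..T}" and fY: "fst (Y n) \<in> {0..T}" for n
    using a Y by (simp_all add: mem_Times_iff)
  have lim: "(\<lambda>n. fst (Y n)) \<longlonglongrightarrow> fst a" "(\<lambda>n. snd (Y n)) \<longlonglongrightarrow> snd a"
    using Y by (auto intro: tendsto_fst tendsto_snd)
  have "\<forall>n. \<exists>y. ode_solution (linearized_field f g T (snd (Y n))) T (fst (Y n)) 0 y"
    using linearized_solution[OF fY] by metis
  then obtain y where y: "\<And>n. ode_solution (linearized_field f g T (snd (Y n))) T (fst (Y n)) 0 (y n)"
    by metis
  obtain z where z: "ode_solution (linearized_field f g T (snd a)) T (fst a) 0 z"
    using linearized_solution[OF fa] by blast
  have "(\<lambda>n. y n t) \<longlonglongrightarrow> z t" if "t \<in> {0..T}" for t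
    by (rule linear_ode_solutions_tendsto[OF linearized_continuous(1,2) _ _ lim(2) fY fa lim(1)
          y[unfolded linearized_field_eq] z[unfolded linearized_field_eq] that]) auto
  then have "(\<lambda>n. y n T - y n 0) \<longlonglongrightarrow> z T - z 0"
    using T_pos by (intro tendsto_diff) auto
  then show "((\<lambda>(s, \<xi>). averaging_operator f g T s \<xi>) \<circ> Y) \<longlonglongrightarrow> (\<lambda>(s, \<xi>). averaging_operator f g T s \<xi>) a"
    by (simp add: o_def case_prod_unfold averaging_operator_eq[OF fY y] averaging_operator_eq[OF fa z])
qed

text \<open>
The first-order expansion of \<open>P\<^sub>\<epsilon>\<close>. Letting \<open>\<xi>\<close> vary along with \<open>\<epsilon>\<close> gives the uniformity in \<open>\<xi>\<close> that a
compactness argument needs.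
\<close>

lemma deviation_tendsto_averaging:
  assumes \<epsilon>: "\<And>k. \<epsilon> k \<in> {0<..1}" "\<epsilon> \<longlonglongrightarrow> 0" and \<xi>: "\<xi> \<longlonglongrightarrow> \<xi>'"
  shows "(\<lambda>k. (perturbed_flow (\<epsilon> k) (\<xi> k) T - \<Omega> (\<xi> k) T) /\<^sub>R \<epsilon> k) \<longlonglongrightarrow> averaging_operator f g T 0 \<xi>'"
proof -
  have 0: "0 \<in> {0..T}" using T_pos by simp
  obtain z where z: "ode_solution (linearized_field f g T \<xi>') T 0 0 z"
    using linearized_solution[OF 0] by blast
  have lin: "deviation_field (0, \<xi>') = linearized_field f g T \<xi>'"
    by (simp add: deviation_field_def linearized_field_eq)
  have "uniform_limit {0..T} (\<lambda>k t. (perturbed_flow (\<epsilon> k) (\<xi> k) t - \<Omega> (\<xi> k) t) /\<^sub>R \<epsilon> k) z sequentially"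
  proof (rule ode_solutions_uniform_limit[OF deviation_field_continuous,
        where p = "\<lambda>k. (\<epsilon> k, \<xi> k)" and q = "(0, \<xi>')" and \<xi> = "\<lambda>_. 0" and \<xi>' = 0])
    show "(\<epsilon> k, \<xi> k) \<in> {0..1} \<times> UNIV" for k using \<epsilon>(1)[of k] by auto
    show "(\<lambda>k. (\<epsilon> k, \<xi> k)) \<longlonglongrightarrow> (0, \<xi>')" by (intro tendsto_Pair \<epsilon> \<xi>)
    show "ode_solution (deviation_field (\<epsilon> k, \<xi> k)) T 0 0 (\<lambda>t. (perturbed_flow (\<epsilon> k) (\<xi> k) t - \<Omega> (\<xi> k) t) /\<^sub>R \<epsilon> k)" for k
      by (rule deviation_solution[OF \<epsilon>(1)])
    show "ode_solution (deviation_field (0, \<xi>')) T 0 0 z" using z lin by simp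
    show "u \<tau> = z \<tau>" if \<tau>: "\<tau> \<in> {0..T}" and u: "ode_solution (deviation_field (0, \<xi>')) \<tau> 0 0 u" for \<tau> u
    proof (rule linear_ode_unique[where s = 0 and t = \<tau>])
      show "continuous_on {0..\<tau>} (\<lambda>t. H t (\<Omega> \<xi>' t) 0)"
        by (rule continuous_on_subset[OF linearized_continuous(3)]) (use \<tau> in auto)
      show "ode_solution (\<lambda>t v. H t (\<Omega> \<xi>' t) 0 v + g t (\<Omega> \<xi>' t) 0) \<tau> 0 0 u"
        using u by (simp add: lin linearized_field_eq)
      show "ode_solution (\<lambda>t v. H t (\<Omega> \<xi>' t) 0 v + g t (\<Omega> \<xi>' t) 0) \<tau> 0 0 z"
        using ode_solution_restrict[OF z \<tau>] by (simp add: linearized_field_eq)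
    qed (use \<tau> in auto)
  qed auto
  then have "(\<lambda>k. (perturbed_flow (\<epsilon> k) (\<xi> k) T - \<Omega> (\<xi> k) T) /\<^sub>R \<epsilon> k) \<longlonglongrightarrow> z T"
    using T_pos by (intro tendsto_uniform_limitI) auto
  moreover have "z 0 = 0" using z by (simp add: ode_solution_def)
  ultimately show ?thesis by (simp add: averaging_operator_eq[OF 0 z])
qed

text \<open>
If it fails, there are \<open>\<epsilon>\<^sub>k \<rightarrow> 0\<close> and \<open>\<xi>\<^sub>k \<rightarrow> \<xi>\<close> in \<open>K\<close> with nonpositive inner products. Divided by \<open>\<epsilon>\<^sub>k\<close>
these tend to \<open>|\<Phi>\<^sup>0(\<xi>)|\<^sup>2\<close>, which is positive.
\<close>

lemma boundary_alignment:
  assumes K: "compact K" and fixed: "\<And>\<xi>. \<xi> \<in> K \<Longrightarrow> \<Omega> \<xi> T = \<xi>"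
    and nz: "\<And>\<xi>. \<xi> \<in> K \<Longrightarrow> averaging_operator f g T 0 \<xi> \<noteq> 0"
  shows "\<exists>\<epsilon>0 > 0. \<epsilon>0 \<le> 1 \<and> (\<forall>\<epsilon>\<in>{0<..\<epsilon>0}. \<forall>\<xi>\<in>K. (perturbed_flow \<epsilon> \<xi> T - \<xi>) \<bullet> averaging_operator f g T 0 \<xi> > 0)"
proof (rule ccontr)
  assume no: "\<not> ?thesis"
  have "\<exists>\<epsilon>. \<exists>\<xi>\<in>K. \<epsilon> \<in> {0<..1 / real (Suc k)} \<and> (perturbed_flow \<epsilon> \<xi> T - \<xi>) \<bullet> averaging_operator f g T 0 \<xi> \<le> 0" for k
  proof -
    have "1 / real (Suc k) > 0 \<and> 1 / real (Suc k) \<le> 1" by simp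
    then show ?thesis using no by (metis not_less)
  qed
  then obtain \<epsilon> \<xi> where \<epsilon>: "\<And>k. \<epsilon> k \<in> {0<..1 / real (Suc k)}" and \<xi>: "\<And>k. \<xi> k \<in> K"
    and le: "\<And>k. (perturbed_flow (\<epsilon> k) (\<xi> k) T - \<xi> k) \<bullet> averaging_operator f g T 0 (\<xi> k) \<le> 0"
    by metis
  obtain \<xi>' r where r: "\<xi>' \<in> K" "strict_mono (r :: nat \<Rightarrow> nat)" "(\<lambda>k. \<xi> (r k)) \<longlonglongrightarrow> \<xi>'"
    by (rule seq_compactE[OF compact_imp_seq_compact[OF K], of \<xi>]) (use \<xi> in \<open>simp_all add: o_def\<close>)
  have "\<epsilon> \<longlonglongrightarrow> 0"
    by (rule tendsto_sandwich[OF _ _ tendsto_const LIMSEQ_inverse_real_of_nat])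
       (use \<epsilon> in \<open>auto simp: inverse_eq_divide less_imp_le\<close>)
  then have \<epsilon>0: "(\<lambda>k. \<epsilon> (r k)) \<longlonglongrightarrow> 0"
    using LIMSEQ_subseq_LIMSEQ[OF _ r(2)] by (auto simp: o_def)
  have \<epsilon>1: "\<epsilon> (r k) \<in> {0<..1}" for k
  proof -
    have "1 / real (Suc (r k)) \<le> 1" by simp
    then show ?thesis using \<epsilon>[of "r k"] by (auto intro: order_trans)
  qed
  let ?\<Phi> = "averaging_operator f g T 0"
  have \<Phi>: "(\<lambda>k. ?\<Phi> (\<xi> (r k))) \<longlonglongrightarrow> ?\<Phi> \<xi>'"
  proof -
    have "(\<lambda>k. (\<lambda>(s, \<xi>). averaging_operator f g T s \<xi>) (0, \<xi> (r k))) \<longlonglongrightarrow> (\<lambda>(s, \<xi>). averaging_operator f g T s \<xi>) (0, \<xi>')"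
      by (rule continuous_on_tendsto_compose[OF averaging_operator_continuous])
         (use T_pos r in \<open>auto intro: tendsto_Pair\<close>)
    then show ?thesis by simp
  qed
  have "(\<lambda>k. ((perturbed_flow (\<epsilon> (r k)) (\<xi> (r k)) T - \<Omega> (\<xi> (r k)) T) /\<^sub>R \<epsilon> (r k)) \<bullet> ?\<Phi> (\<xi> (r k))) \<longlonglongrightarrow> ?\<Phi> \<xi>' \<bullet> ?\<Phi> \<xi>'"
    by (intro tendsto_inner \<Phi> deviation_tendsto_averaging \<epsilon>1 \<epsilon>0 r)
  moreover have "((perturbed_flow (\<epsilon> (r k)) (\<xi> (r k)) T - \<Omega> (\<xi> (r k)) T) /\<^sub>R \<epsilon> (r k)) \<bullet> ?\<Phi> (\<xi> (r k)) \<le> 0" for k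
    using le[of "r k"] \<epsilon>1[of k] fixed[OF \<xi>] by (auto simp: mult_nonneg_nonpos)
  ultimately have "?\<Phi> \<xi>' \<bullet> ?\<Phi> \<xi>' \<le> 0"
    by (intro LIMSEQ_le_const2) auto
  then show False using nz[OF r(1)] by (simp add: power2_norm_eq_inner[symmetric])
qed

text \<open>
The straight line from \<open>I - P\<^sub>\<epsilon>\<close> to \<open>-\<Phi>\<^sup>0\<close> does not meet zero on the boundary because both ends
have a negative inner product with \<open>\<Phi>\<^sup>0\<close> there; afterwards \<open>s\<close> moves from \<open>0\<close> to \<open>T\<close>.
\<close>

lemma degree_perturbed_flow:
  assumes U: "open U" "bounded U" and \<epsilon>: "\<epsilon> \<in> {0<..1}"
    and aligned: "\<And>\<xi>. \<xi> \<in> frontier U \<Longrightarrow> (perturbed_flow \<epsilon> \<xi> T - \<xi>) \<bullet> averaging_operator f g T 0 \<xi> > 0"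
    and nz: "\<And>\<xi> s. \<xi> \<in> frontier U \<Longrightarrow> s \<in> {0..T} \<Longrightarrow> averaging_operator f g T s \<xi> \<noteq> 0"
  shows "brouwer_degree (\<lambda>\<xi>. \<xi> - perturbed_flow \<epsilon> \<xi> T) U = brouwer_degree (\<lambda>\<xi>. - averaging_operator f g T T \<xi>) U"
proof -
  let ?\<Phi> = "averaging_operator f g T"
  have \<Phi>: "continuous_on S (\<lambda>z. ?\<Phi> (s z) (\<xi> z))"
    if "continuous_on S s" "continuous_on S \<xi>" "\<And>z. z \<in> S \<Longrightarrow> s z \<in> {0..T}" for S :: "(real \<times> 'a) set" and s \<xi>
  proof -
    have "continuous_on S (\<lambda>z. (\<lambda>(s, \<xi>). ?\<Phi> s \<xi>) (s z, \<xi> z))"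
      by (rule continuous_on_compose2[OF averaging_operator_continuous])
         (use that in \<open>auto intro!: continuous_intros\<close>)
    then show ?thesis by simp
  qed
  define h where "h \<tau> \<xi> = (1 - \<tau>) *\<^sub>R (\<xi> - perturbed_flow \<epsilon> \<xi> T) + \<tau> *\<^sub>R (- ?\<Phi> 0 \<xi>)" for \<tau> \<xi>
  have "brouwer_degree (h 0) U = brouwer_degree (h 1) U"
  proof (rule brouwer_degree_homotopy[OF U])
    have "continuous_on ({0..1} \<times> closure U) (\<lambda>z :: real \<times> 'a. (\<lambda>(\<xi>, t). perturbed_flow \<epsilon> \<xi> t) (snd z, T))"
      by (rule continuous_on_compose2[OF perturbed_flow_continuous[OF \<epsilon>]])
         (use T_pos in \<open>auto intro!: continuous_intros\<close>)
    then show "continuous_on ({0..1} \<times> closure U) (\<lambda>(\<tau>, \<xi>). h \<tau> \<xi>)"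
      unfolding h_def case_prod_unfold using T_pos by (intro continuous_intros \<Phi>) auto
    show "h \<tau> \<xi> \<noteq> 0" if \<tau>: "\<tau> \<in> {0..1}" and \<xi>: "\<xi> \<in> frontier U" for \<tau> \<xi>
    proof
      assume "h \<tau> \<xi> = 0"
      then have "h \<tau> \<xi> \<bullet> ?\<Phi> 0 \<xi> = 0" by simp
      then have 0: "(1 - \<tau>) * ((perturbed_flow \<epsilon> \<xi> T - \<xi>) \<bullet> ?\<Phi> 0 \<xi>) + \<tau> * (?\<Phi> 0 \<xi> \<bullet> ?\<Phi> 0 \<xi>) = 0"
        by (simp add: h_def inner_add_left inner_diff_left algebra_simps)
      have pos: "(perturbed_flow \<epsilon> \<xi> T - \<xi>) \<bullet> ?\<Phi> 0 \<xi> > 0" "?\<Phi> 0 \<xi> \<bullet> ?\<Phi> 0 \<xi> > 0"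
        using aligned[OF \<xi>] nz[OF \<xi>, of 0] T_pos by simp_all
      show False
      proof (cases "\<tau> = 0")
        case False
        then have "\<tau> * (?\<Phi> 0 \<xi> \<bullet> ?\<Phi> 0 \<xi>) > 0" using \<tau> pos by simp
        moreover have "(1 - \<tau>) * ((perturbed_flow \<epsilon> \<xi> T - \<xi>) \<bullet> ?\<Phi> 0 \<xi>) \<ge> 0" using \<tau> pos by simp
        ultimately show ?thesis using 0 by linarith
      qed (use 0 pos in simp)
    qed
  qed
  moreover have "brouwer_degree (\<lambda>\<xi>. - ?\<Phi> (0 * T) \<xi>) U = brouwer_degree (\<lambda>\<xi>. - ?\<Phi> (1 * T) \<xi>) U"
  proof (rule brouwer_degree_homotopy[OF U])
    have range: "\<tau> * T \<in> {0..T}" if "\<tau> \<in> {0..1}" for \<tau>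
      using that T_pos by (simp add: mult_left_le_one_le)
    show "continuous_on ({0..1} \<times> closure U) (\<lambda>(\<tau>, \<xi>). - ?\<Phi> (\<tau> * T) \<xi>)"
      unfolding case_prod_unfold by (intro continuous_intros \<Phi> range) auto
    show "- ?\<Phi> (\<tau> * T) \<xi> \<noteq> 0" if "\<tau> \<in> {0..1}" "\<xi> \<in> frontier U" for \<tau> \<xi>
      using nz[OF that(2) range[OF that(1)]] by simp
  qed
  moreover have "h 0 = (\<lambda>\<xi>. \<xi> - perturbed_flow \<epsilon> \<xi> T)" "h 1 = (\<lambda>\<xi>. - ?\<Phi> 0 \<xi>)"
    by (simp_all add: h_def fun_eq_iff)
  ultimately show ?thesis by simp
qed

end

section \<open>Degree of the translation operator\<close>

theorem mainTheorem4:
  fixes f :: "real \<Rightarrow> real ^ 'n \<Rightarrow> real ^ 'n"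
    and g :: "real \<Rightarrow> real ^ 'n \<Rightarrow> real \<Rightarrow> real ^ 'n"
    and T :: real
    and U :: "(real ^ 'n) set"
  assumes T_pos: "T > 0"
    and f_C1: "continuously_differentiable (\<lambda>(t, x). f t x)"
    and g_cont: "continuous_on (UNIV \<times> UNIV \<times> {0..1}) (\<lambda>(t, x, \<epsilon>). g t x \<epsilon>)"
    and f_periodic: "\<And>t x. f (t + T) x = f t x"
    and g_periodic: "\<And>t x \<epsilon>. \<epsilon> \<in> {0..1} \<Longrightarrow> g (t + T) x \<epsilon> = g t x \<epsilon>"
    and unperturbed_global: "\<And>t0 \<xi>. t0 \<in> {0..T} \<Longrightarrow> \<exists>x. ode_solution f T t0 \<xi> x"
    and U: "open U" "bounded U"
    and boundary_fixed: "\<And>\<xi>. \<xi> \<in> frontier U \<Longrightarrow> poincare_map f g T 0 \<xi> = \<xi>"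
    and perturbed_unique_global: "\<And>t0 \<xi> \<epsilon>. t0 \<in> {0..T} \<Longrightarrow> \<epsilon> \<in> {0<..1} \<Longrightarrow>
      \<exists>x. ode_solution (perturbed_field f g \<epsilon>) T t0 \<xi> x \<and>
        (\<forall>y. ode_solution (perturbed_field f g \<epsilon>) T t0 \<xi> y \<longrightarrow> (\<forall>t\<in>{0..T}. y t = x t))"
    and averaging_nonzero: "\<And>\<xi> s. \<xi> \<in> frontier U \<Longrightarrow> s \<in> {0..T} \<Longrightarrow> averaging_operator f g T s \<xi> \<noteq> 0"
  shows "\<exists>\<epsilon>0 > 0. \<epsilon>0 \<le> 1 \<and> (\<forall>\<epsilon>\<in>{0<..\<epsilon>0}.
    (\<forall>\<xi>\<in>frontier U. poincare_map f g T \<epsilon> \<xi> \<noteq> \<xi>) \<and>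
    brouwer_degree (\<lambda>\<xi>. \<xi> - poincare_map f g T \<epsilon> \<xi>) U =
    brouwer_degree (\<lambda>\<xi>. - averaging_operator f g T T \<xi>) U)"
proof -
  obtain H :: "real \<Rightarrow> real ^ 'n \<Rightarrow> real ^ 'n \<Rightarrow> (real ^ 'n) \<Rightarrow>\<^sub>L (real ^ 'n)" where
    H: "continuous_on UNIV (\<lambda>(t, x, h). H t x h)" "\<And>t x h. f t (x + h) = f t x + H t x h h"
      "\<And>t x. (f t has_derivative H t x 0) (at x)"
    using hadamard_quotient[OF f_C1] by blast
  have "continuous_on UNIV (\<lambda>(t, x). f t x)"
    using f_C1 has_derivative_continuous continuous_at_imp_continuous_on
    unfolding continuously_differentiable_def by blast
  then interpret smooth_perturbation f g T H
    using T_pos g_cont H unperturbed_global[of 0] perturbed_unique_global by unfold_locales auto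
  have P: "poincare_map f g T \<epsilon> \<xi> = perturbed_flow \<epsilon> \<xi> T" for \<epsilon> \<xi>
    by (simp add: poincare_map_def perturbed_flow_def)
  have "perturbed_field f g 0 = f"
    by (simp add: perturbed_field_def fun_eq_iff)
  then have "\<Omega> \<xi> T = \<xi>" if "\<xi> \<in> frontier U" for \<xi>
    using boundary_fixed[OF that] by (simp add: poincare_map_def \<Omega>_def)
  moreover have "averaging_operator f g T 0 \<xi> \<noteq> 0" if "\<xi> \<in> frontier U" for \<xi>
    using averaging_nonzero[OF that, of 0] T_pos by simp
  ultimately obtain \<epsilon>0 where \<epsilon>0: "\<epsilon>0 > 0" "\<epsilon>0 \<le> 1"
    and aligned: "\<And>\<epsilon> \<xi>. \<epsilon> \<in> {0<..\<epsilon>0} \<Longrightarrow> \<xi> \<in> frontier U \<Longrightarrow>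
      (perturbed_flow \<epsilon> \<xi> T - \<xi>) \<bullet> averaging_operator f g T 0 \<xi> > 0"
    using boundary_alignment[OF compact_frontier_bounded[OF U(2)]] by blast
  show ?thesis
  proof (intro exI[of _ \<epsilon>0] conjI ballI \<epsilon>0)
    fix \<epsilon> assume \<epsilon>: "\<epsilon> \<in> {0<..\<epsilon>0}"
    show "poincare_map f g T \<epsilon> \<xi> \<noteq> \<xi>" if "\<xi> \<in> frontier U" for \<xi>
      using aligned[OF \<epsilon> that] by (auto simp: P)
    show "brouwer_degree (\<lambda>\<xi>. \<xi> - poincare_map f g T \<epsilon> \<xi>) U =
        brouwer_degree (\<lambda>\<xi>. - averaging_operator f g T T \<xi>) U"
      unfolding P using \<epsilon> \<epsilon>0 by (intro degree_perturbed_flow U aligned averaging_nonzero) auto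
  qed
qed

end
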